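(* Let $r$ be an odd prime and let $n\ge1$ not be a multiple of $r$. Then for every $1\le s<r$, $$N_{\zeta^s}(n)\le N_{1}(n)\quad\text{and}\quad N_{-\zeta^s}(n)\le N_{-1}(n).$$
   Context: $G(n,r)=\mathbb{Z}_r^n\rtimes S_n$, where $\mathbb{Z}_r=\mathbb{Z}/r\mathbb{Z}$ and $S_n$ permutes coordinates; $G(0,r)$ is trivial. $P(n,r)$ is the set of $r$-tuples $\lambda=(\lambda_1,\dots,\lambda_r)$ of partitions (possibly empty) with $\sum_k|\lambda_k|=n$. Fix a primitive $r$-th root of unity $\zeta$; also write $\zeta$ for the character $\zeta(x;w)=\zeta^{x_1+\dots+x_n}$ of $G(n,r)$ and $\mathrm{sgn}(x;w)$ for the sign of $w$. For a partition $\mu$ of $m$, let $\rho_\mu$ be the corresponding irreducible complex representation of $S_m$ and $\rho_\mu^k(x;w)=\zeta^{k(x_1+\dots+x_m)}\rho_\mu(w)$ its extension to $G(m,r)$. With $a_k=|\lambda_k|$, the irreducible representation of $G(n,r)$ indexed by $\lambda$ is $$\rho_\lambda=\mathrm{Ind}_{G(a_1,r)\times\dots\times G(a_r,r)}^{G(n,r)}\ \rho_{\lambda_1}^{0}\boxtimes\rho_{\lambda_2}^{1}\boxtimes\dots\boxtimes\rho_{\lambda_r}^{r-1}.$$ $N_{\zeta^s}(n)$ (resp. $N_{-\zeta^s}(n)$) is the number of $\lambda\in P(n,r)$ such that the character $\det\rho_\lambda$ equals $\zeta^s$ (resp. $\zeta^s\cdot\mathrm{sgn}$); $N_1=N_{\zeta^r}$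 and $N_{-1}=N_{-\zeta^r}$. For $n=1$, where $\mathrm{sgn}$ is trivial, $N_{-\zeta^s}(1)=0$ for all $s$. *)

theory Defs
  imports
    "HOL-Library.Function_Algebras"
    "HOL-Algebra.Sym_Groups"
    "HOL-Algebra.Product_Groups"
    "HOL-Algebra.Elementary_Groups"
    "HOL-Computational_Algebra.Primes"
    "Jordan_Normal_Form.Determinant"
begin

section \<open>Complex vector spaces of functions\<close>

definition fscale :: "complex \<Rightarrow> ('b \<Rightarrow> complex) \<Rightarrow> ('b \<Rightarrow> complex)"
  where "fscale c f = (\<lambda>x. c * f x)"

interpretation fvs: vector_space "fscale :: complex \<Rightarrow> ('b \<Rightarrow> complex) \<Rightarrow> ('b \<Rightarrow> complex)"
  by unfold_locales (simp_all add: fscale_def fun_eq_iff distrib_left distrib_right mult.assoc)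

definition is_basis_list :: "('b \<Rightarrow> complex) set \<Rightarrow> ('b \<Rightarrow> complex) list \<Rightarrow> bool"
  where "is_basis_list V bs \<longleftrightarrow> distinct bs \<and> fvs.independent (set bs) \<and> fvs.span (set bs) = V"

text \<open>Determinant of an endomorphism of a finite-dimensional space \<open>V\<close>: the determinant of its
  matrix in some ordered basis.\<close>

definition op_det :: "('b \<Rightarrow> complex) set \<Rightarrow> (('b \<Rightarrow> complex) \<Rightarrow> ('b \<Rightarrow> complex)) \<Rightarrow> complex"
  where "op_det V T =
    (let bs = (SOME bs. is_basis_list V bs)
     in det (mat (length bs) (length bs)
               (\<lambda>(i, j). fvs.representation (set bs) (T (bs ! j)) (bs ! i))))"

section \<open>Representations\<close>

text \<open>A representation of a group with elements of type \<open>'g\<close>: a space of functions together with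
  the operators by which the group elements act on it.  Only the values of the operators on
  \<open>rep_space\<close> are relevant.\<close>

record ('g, 'b) rep =
  rep_space :: "('b \<Rightarrow> complex) set"
  rep_act :: "'g \<Rightarrow> ('b \<Rightarrow> complex) \<Rightarrow> ('b \<Rightarrow> complex)"

definition rep_det :: "('g, 'b) rep \<Rightarrow> 'g \<Rightarrow> complex"
  where "rep_det \<rho> g = op_det (rep_space \<rho>) (rep_act \<rho> g)"

text \<open>External tensor products.  The tensor product of spaces \<open>V\<^sub>k\<close> of functions on a set \<open>X\<close> is
  realised by functions on tuples of elements of \<open>X\<close>, the pure tensor of a family \<open>v\<close> being
  the product function; it is independent of the components of a tuple outside \<open>K\<close>.\<close>

definition pure_tensor :: "'k set \<Rightarrow> ('k \<Rightarrow> 'b \<Rightarrow> complex) \<Rightarrow> (('k \<Rightarrow> 'b) \<Rightarrow> complex)"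
  where "pure_tensor K v = (\<lambda>\<beta>. \<Prod>k\<in>K. v k (\<beta> k))"

definition tensor_space :: "'k set \<Rightarrow> ('k \<Rightarrow> ('b \<Rightarrow> complex) set) \<Rightarrow> (('k \<Rightarrow> 'b) \<Rightarrow> complex) set"
  where "tensor_space K V = fvs.span {pure_tensor K v | v. \<forall>k\<in>K. v k \<in> V k}"

text \<open>The tensor product of operators: the linear map sending the pure tensor of the \<open>v k\<close> to that
  of the \<open>T k (v k)\<close>.  On \<open>tensor_space K V\<close> it is determined by this condition.\<close>

definition is_tensor_op ::
  "'k set \<Rightarrow> ('k \<Rightarrow> ('b \<Rightarrow> complex) set) \<Rightarrow> ('k \<Rightarrow> ('b \<Rightarrow> complex) \<Rightarrow> ('b \<Rightarrow> complex)) \<Rightarrow>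
   ((('k \<Rightarrow> 'b) \<Rightarrow> complex) \<Rightarrow> (('k \<Rightarrow> 'b) \<Rightarrow> complex)) \<Rightarrow> bool"
  where "is_tensor_op K V T L \<longleftrightarrow>
    Vector_Spaces.linear fscale fscale L \<and>
    (\<forall>v. (\<forall>k\<in>K. v k \<in> V k) \<longrightarrow> L (pure_tensor K v) = pure_tensor K (\<lambda>k. T k (v k)))"

definition tensor_op ::
  "'k set \<Rightarrow> ('k \<Rightarrow> ('b \<Rightarrow> complex) set) \<Rightarrow> ('k \<Rightarrow> ('b \<Rightarrow> complex) \<Rightarrow> ('b \<Rightarrow> complex)) \<Rightarrow>
   (('k \<Rightarrow> 'b) \<Rightarrow> complex) \<Rightarrow> (('k \<Rightarrow> 'b) \<Rightarrow> complex)"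
  where "tensor_op K V T = (SOME L. is_tensor_op K V T L)"

lemma is_tensor_op_unique:
  fixes V :: "'k \<Rightarrow> ('b \<Rightarrow> complex) set"
  assumes "is_tensor_op K V T L" "is_tensor_op K V T L'" "F \<in> tensor_space K V"
  shows "L F = L' F"
proof -
  let ?B = "{pure_tensor K v | v. \<forall>k\<in>K. v k \<in> V k}"
  have "vector_space_pair
      (fscale :: complex \<Rightarrow> (('k \<Rightarrow> 'b) \<Rightarrow> complex) \<Rightarrow> (('k \<Rightarrow> 'b) \<Rightarrow> complex))
      (fscale :: complex \<Rightarrow> (('k \<Rightarrow> 'b) \<Rightarrow> complex) \<Rightarrow> (('k \<Rightarrow> 'b) \<Rightarrow> complex))"
    by (simp add: vector_space_pair_def fvs.vector_space_axioms)
  moreover have "Vector_Spaces.linear fscale fscale L" "Vector_Spaces.linear fscale fscale L'"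
    using assms(1,2) unfolding is_tensor_op_def by blast+
  moreover have "L F' = L' F'" if "F' \<in> ?B" for F'
  proof -
    from that obtain v where "F' = pure_tensor K v" "\<forall>k\<in>K. v k \<in> V k"
      by blast
    with assms(1,2) show ?thesis
      unfolding is_tensor_op_def by metis
  qed
  moreover have "F \<in> fvs.span ?B"
    using assms(3) unfolding tensor_space_def .
  ultimately show ?thesis
    by (rule vector_space_pair.linear_eq_on_span)
qed

text \<open>Existence for operators that permute the coordinates up to a scalar, as all the operators
  tensored below do.\<close>

lemma is_tensor_op_monomial:
  fixes V :: "'k \<Rightarrow> ('b \<Rightarrow> complex) set"
  assumes "\<And>k v. k \<in> K \<Longrightarrow> T k v = (\<lambda>b. c k * v (p k b))"
  shows "is_tensor_op K V T (\<lambda>F \<beta>. (\<Prod>k\<in>K. c k) * F (\<lambda>k. p k (\<beta> k)))"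
proof -
  have "Vector_Spaces.linear fscale fscale
      (\<lambda>(F :: ('k \<Rightarrow> 'b) \<Rightarrow> complex) \<beta>. (\<Prod>k\<in>K. c k) * F (\<lambda>k. p k (\<beta> k)))"
    unfolding Vector_Spaces.linear_iff
    by (intro conjI allI fvs.vector_space_axioms ext)
       (simp_all only: fscale_def plus_fun_def distrib_left mult.left_commute)
  moreover have "(\<Prod>k\<in>K. c k) * pure_tensor K v (\<lambda>k. p k (\<beta> k)) =
      pure_tensor K (\<lambda>k. T k (v k)) \<beta>" for v \<beta>
    by (simp add: pure_tensor_def assms prod.distrib)
  ultimately show ?thesis
    unfolding is_tensor_op_def by (simp add: fun_eq_iff)
qed

definition ext_tensor ::
  "'k set \<Rightarrow> ('k \<Rightarrow> ('g, 'b) rep) \<Rightarrow> ('k \<Rightarrow> 'g, 'k \<Rightarrow> 'b) rep"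
  where "ext_tensor K \<rho> = \<lparr>
    rep_space = tensor_space K (\<lambda>k. rep_space (\<rho> k)),
    rep_act = (\<lambda>g. tensor_op K (\<lambda>k. rep_space (\<rho> k)) (\<lambda>k. rep_act (\<rho> k) (g k)))\<rparr>"

definition pullback_rep :: "('h \<Rightarrow> 'g) \<Rightarrow> ('g, 'b) rep \<Rightarrow> ('h, 'b) rep"
  where "pullback_rep \<phi> \<rho> = \<lparr>rep_space = rep_space \<rho>, rep_act = (\<lambda>h. rep_act \<rho> (\<phi> h))\<rparr>"

text \<open>The representation of \<open>G\<close> induced from a representation of a subgroup \<open>H\<close>: \<open>G\<close> acts by right
  translation on the functions \<open>f\<close> from \<open>G\<close> to the space of \<open>\<rho>\<close> with \<open>f (h g) = \<rho> h (f g)\<close>.  Such a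
  function is stored in uncurried form and extended by zero outside the carrier.\<close>

definition induced_rep ::
  "('g, 'm) monoid_scheme \<Rightarrow> 'g set \<Rightarrow> ('g, 'b) rep \<Rightarrow> ('g, 'g \<times> 'b) rep"
  where "induced_rep G H \<rho> = \<lparr>
    rep_space = {F. (\<forall>g b. g \<notin> carrier G \<longrightarrow> F (g, b) = 0) \<and>
      (\<forall>g\<in>carrier G. (\<lambda>b. F (g, b)) \<in> rep_space \<rho>) \<and>
      (\<forall>h\<in>H. \<forall>g\<in>carrier G. (\<lambda>b. F (h \<otimes>\<^bsub>G\<^esub> g, b)) = rep_act \<rho> h (\<lambda>b. F (g, b)))},
    rep_act = (\<lambda>x F. \<lambda>(g, b). if g \<in> carrier G then F (g \<otimes>\<^bsub>G\<^esub> x, b) else 0)\<rparr>"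

section \<open>Partitions and Specht modules\<close>

definition is_partition :: "nat list \<Rightarrow> nat \<Rightarrow> bool"
  where "is_partition \<mu> m \<longleftrightarrow> sorted_wrt (\<ge>) \<mu> \<and> 0 \<notin> set \<mu> \<and> sum_list \<mu> = m"

definition cells :: "nat list \<Rightarrow> (nat \<times> nat) set"
  where "cells \<mu> = {(i, j). i < length \<mu> \<and> j < \<mu> ! i}"

text \<open>Tableaux are extended by 0 outside the diagram; a permutation of \<open>{1..m}\<close> fixes 0, so it acts
  on tableaux by composition.\<close>

type_synonym tableau = "nat \<times> nat \<Rightarrow> nat"
type_synonym tabloid = "tableau set"

definition is_tableau :: "nat list \<Rightarrow> tableau \<Rightarrow> bool"
  where "is_tableau \<mu> t \<longleftrightarrow> bij_betw t (cells \<mu>) {1..sum_list \<mu>} \<and> (\<forall>c. c \<notin> cells \<mu> \<longrightarrow> t c = 0)"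

definition row_stabilizer :: "nat list \<Rightarrow> tableau \<Rightarrow> (nat \<Rightarrow> nat) set"
  where "row_stabilizer \<mu> t = {\<pi>. \<pi> permutes {1..sum_list \<mu>} \<and>
    (\<forall>i. \<pi> ` t ` {c \<in> cells \<mu>. fst c = i} = t ` {c \<in> cells \<mu>. fst c = i})}"

definition column_stabilizer :: "nat list \<Rightarrow> tableau \<Rightarrow> (nat \<Rightarrow> nat) set"
  where "column_stabilizer \<mu> t = {\<pi>. \<pi> permutes {1..sum_list \<mu>} \<and>
    (\<forall>j. \<pi> ` t ` {c \<in> cells \<mu>. snd c = j} = t ` {c \<in> cells \<mu>. snd c = j})}"

definition tabloid_of :: "nat list \<Rightarrow> tableau \<Rightarrow> tabloid"
  where "tabloid_of \<mu> t = {\<pi> \<circ> t | \<pi>. \<pi> \<in> row_stabilizer \<mu> t}"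

definition tabloid_act :: "(nat \<Rightarrow> nat) \<Rightarrow> tabloid \<Rightarrow> tabloid"
  where "tabloid_act w X = (\<lambda>t. w \<circ> t) ` X"

definition polytabloid :: "nat list \<Rightarrow> tableau \<Rightarrow> (tabloid \<Rightarrow> complex)"
  where "polytabloid \<mu> t = (\<lambda>X. \<Sum>\<pi>\<in>column_stabilizer \<mu> t.
    of_int (sign \<pi>) * (if X = tabloid_act \<pi> (tabloid_of \<mu> t) then 1 else 0))"

text \<open>The irreducible representation of the symmetric group indexed by \<open>\<mu>\<close> is the Specht module,
  the span of the polytabloids in the permutation module on tabloids; the one-row partition gives
  the trivial representation and the one-column partition the sign.\<close>

definition specht :: "nat list \<Rightarrow> (nat \<Rightarrow> nat, tabloid) rep"
  where "specht \<mu> = \<lparr>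
    rep_space = fvs.span {polytabloid \<mu> t | t. is_tableau \<mu> t},
    rep_act = (\<lambda>w f X. f (tabloid_act (inv' w) X))\<rparr>"

section \<open>The groups G(n,r) and their irreducible representations\<close>

type_synonym wr = "(nat \<Rightarrow> int) \<times> (nat \<Rightarrow> nat)"

definition wreath :: "nat \<Rightarrow> nat \<Rightarrow> wr monoid"
  where "wreath n r =
    (let A = product_group {1..n} (\<lambda>_. integer_mod_group r) in \<lparr>
      carrier = carrier A \<times> carrier (sym_group n),
      monoid.mult = (\<lambda>(x, w) (y, v). (x \<otimes>\<^bsub>A\<^esub> (\<lambda>i\<in>{1..n}. y (inv' w i)), w \<circ> v)),
      one = (\<one>\<^bsub>A\<^esub>, id)\<rparr>)"

definition primitive_root :: "nat \<Rightarrow> complex \<Rightarrow> bool"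
  where "primitive_root r \<zeta> \<longleftrightarrow> \<zeta> ^ r = 1 \<and> (\<forall>k. 0 < k \<and> k < r \<longrightarrow> \<zeta> ^ k \<noteq> 1)"

definition zeta_char :: "complex \<Rightarrow> nat \<Rightarrow> wr \<Rightarrow> complex"
  where "zeta_char \<zeta> n = (\<lambda>(x, w). \<zeta> powi (\<Sum>i\<in>{1..n}. x i))"

definition sgn_char :: "wr \<Rightarrow> complex"
  where "sgn_char = (\<lambda>(x, w). of_int (sign w))"

definition ext_specht :: "complex \<Rightarrow> nat \<Rightarrow> nat list \<Rightarrow> (wr, tabloid) rep"
  where "ext_specht \<zeta> k \<mu> = \<lparr>
    rep_space = rep_space (specht \<mu>),
    rep_act = (\<lambda>g f. fscale (zeta_char \<zeta> (sum_list \<mu>) g ^ k) (rep_act (specht \<mu>) (snd g) f))\<rparr>"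

definition multipartitions :: "nat \<Rightarrow> nat \<Rightarrow> nat list list set"
  where "multipartitions n r = {lam. length lam = r \<and> (\<forall>\<mu>\<in>set lam. is_partition \<mu> (sum_list \<mu>)) \<and>
    (\<Sum>k<r. sum_list (lam ! k)) = n}"

text \<open>The product of the groups \<open>G(a\<^sub>k, r)\<close> sits in \<open>G(n, r)\<close> as the subgroup of all \<open>(x; w)\<close> whose \<open>w\<close>
  preserves the consecutive blocks of sizes \<open>a\<^sub>k\<close>; \<open>young_component\<close> is its projection to the factor
  with index \<open>k\<close>.\<close>

definition block_start :: "nat list list \<Rightarrow> nat \<Rightarrow> nat"
  where "block_start lam k = (\<Sum>j<k. sum_list (lam ! j))"

definition block :: "nat list list \<Rightarrow> nat \<Rightarrow> nat set"
  where "block lam k = {block_start lam k + 1..block_start lam k + sum_list (lam ! k)}"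

definition young_subgroup :: "nat \<Rightarrow> nat \<Rightarrow> nat list list \<Rightarrow> wr set"
  where "young_subgroup n r lam =
    {(x, w) \<in> carrier (wreath n r). \<forall>k<r. w ` block lam k = block lam k}"

definition young_component :: "nat list list \<Rightarrow> wr \<Rightarrow> nat \<Rightarrow> wr"
  where "young_component lam = (\<lambda>(x, w) k.
    (\<lambda>i\<in>{1..sum_list (lam ! k)}. x (block_start lam k + i),
     \<lambda>i. if i \<in> {1..sum_list (lam ! k)}
          then w (block_start lam k + i) - block_start lam k else i))"

text \<open>The tuple is indexed from 0, so the partition with index \<open>k\<close> carries the \<open>k\<close>-th power of the
  character \<open>\<zeta>\<close>.\<close>

definition wreath_irrep ::
  "complex \<Rightarrow> nat \<Rightarrow> nat \<Rightarrow> nat list list \<Rightarrow> (wr, wr \<times> (nat \<Rightarrow> tabloid)) rep"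
  where "wreath_irrep \<zeta> n r lam =
    induced_rep (wreath n r) (young_subgroup n r lam)
      (pullback_rep (young_component lam)
        (ext_tensor {..<r} (\<lambda>k. ext_specht \<zeta> k (lam ! k))))"

section \<open>Counting by determinant\<close>

definition N_plus :: "complex \<Rightarrow> nat \<Rightarrow> nat \<Rightarrow> nat \<Rightarrow> nat"
  where "N_plus \<zeta> r s n = card {lam \<in> multipartitions n r.
    \<forall>g\<in>carrier (wreath n r). rep_det (wreath_irrep \<zeta> n r lam) g = zeta_char \<zeta> n g ^ s}"

text \<open>For \<open>n = 1\<close> the sign character is trivial and the count is 0 by convention.\<close>

definition N_minus :: "complex \<Rightarrow> nat \<Rightarrow> nat \<Rightarrow> nat \<Rightarrow> nat"
  where "N_minus \<zeta> r s n = (if n = 1 then 0 else card {lam \<in> multipartitions n r.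
    \<forall>g\<in>carrier (wreath n r).
      rep_det (wreath_irrep \<zeta> n r lam) g = zeta_char \<zeta> n g ^ s * sgn_char g})"

end

theory Submission
  imports Defs "HOL-Number_Theory.Cong"
begin

text \<open>Rotating a multipartition twists the irreducible representation by a power of the character
  \<open>\<zeta>\<close>, so among the rotations of \<open>\<lambda>\<close> the determinant character changes by powers of
  \<open>\<zeta>\<^sup>d\<close>, where \<open>d = dim \<rho>\<^sub>\<lambda>\<close>.  The central element \<open>(1, \<dots>, 1; id)\<close> acts by a scalar that is an
  \<open>r\<close>-th root of unity; if \<open>r\<close> divides \<open>d\<close> its determinant is therefore 1, whereas \<open>\<zeta>\<^sup>s\<close> takes the value
  \<open>\<zeta>\<^sup>n\<^sup>s \<noteq> 1\<close> there.  Hence every \<open>\<lambda>\<close> counted on the left has \<open>d\<close> invertible modulo \<open>r\<close>, and rotating it by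
  \<open>s / d\<close> steps modulo \<open>r\<close> removes the factor \<open>\<zeta>\<^sup>s\<close>.  As \<open>d\<close> is invariant under rotation, this
  map is injective.\<close>

section \<open>Determinants of intertwined operators\<close>

text \<open>Two bases are allowed, over different index types, so that a map between two
  representations has a matrix too; with \<open>bs = cs\<close> it is the matrix inside
  \<open>op_det\<close>.\<close>

definition op_mat ::
  "('b \<Rightarrow> complex) list \<Rightarrow> ('a \<Rightarrow> complex) list \<Rightarrow> (('a \<Rightarrow> complex) \<Rightarrow> ('b \<Rightarrow> complex)) \<Rightarrow> complex mat"
  where "op_mat bs cs f = mat (length bs) (length cs)
    (\<lambda>(i, j). fvs.representation (set bs) (f (cs ! j)) (bs ! i))"

text \<open>The basis picked by \<open>SOME\<close> in \<open>op_det\<close> depends on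
  \<open>V\<close> alone, so one list computes the determinants of all operators on
  \<open>V\<close>.\<close>

lemma op_det_basis:
  assumes "\<exists>bs. is_basis_list V bs"
  obtains bs where "is_basis_list V bs" "\<And>T. op_det V T = det (op_mat bs bs T)"
proof
  show "is_basis_list V (SOME bs. is_basis_list V bs)"
    using assms by (rule someI_ex)
qed (simp add: op_det_def op_mat_def Let_def)

lemma is_basis_list_length:
  "is_basis_list V bs \<Longrightarrow> length bs = fvs.dim V"
  unfolding is_basis_list_def
  by (metis distinct_card fvs.dim_span_eq_card_independent)

lemma is_basis_list_nth: "is_basis_list V bs \<Longrightarrow> i < length bs \<Longrightarrow> bs ! i \<in> V"
  unfolding is_basis_list_def by (metis fvs.span_base nth_mem)

text \<open>An independent set in the span of a finite \<open>S\<close> has at most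
  \<open>card S\<close> elements and can therefore be listed; \<open>S\<close> itself may lie
  outside \<open>V\<close>.\<close>

lemma is_basis_list_exists:
  assumes "fvs.subspace V" "V \<subseteq> fvs.span S" "finite S"
  shows "\<exists>bs. is_basis_list V bs"
proof -
  obtain B where B: "B \<subseteq> V" "fvs.independent B" "V \<subseteq> fvs.span B"
    by (rule fvs.basis_exists)
  moreover have "finite B"
    using fvs.independent_span_bound[OF assms(3) B(2)] B(1) assms(2) by blast
  ultimately show ?thesis
    using assms(1) unfolding is_basis_list_def
    by (metis finite_distinct_list fvs.span_minimal subset_antisym)
qed

lemma basis_expansion:
  assumes "is_basis_list V bs" "v \<in> V"
  shows "v = (\<Sum>k<length bs. fscale (fvs.representation (set bs) v (bs ! k)) (bs ! k))"
proof -
  have "v = (\<Sum>b\<in>set bs. fscale (fvs.representation (set bs) v b) b)"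
    using assms fvs.sum_representation_eq[of "set bs" v "set bs"] by (simp add: is_basis_list_def)
  also have "\<dots> = (\<Sum>k<length bs. fscale (fvs.representation (set bs) v (bs ! k)) (bs ! k))"
    using assms by (intro sum.reindex_bij_betw[symmetric] bij_betw_nth) (auto simp: is_basis_list_def)
  finally show ?thesis .
qed

lemma representation_nth:
  assumes "is_basis_list V bs" "i < length bs" "j < length bs"
  shows "fvs.representation (set bs) (bs ! j) (bs ! i) = (if i = j then 1 else 0)"
  using assms by (simp add: is_basis_list_def fvs.representation_basis nth_eq_iff_index_eq)

text \<open>Expand \<open>g (ds ! j)\<close> in the basis \<open>cs\<close> and apply
  \<open>f\<close>; taking a coordinate with respect to \<open>bs\<close> is linear on
  \<open>U\<close>, which contains every \<open>f (cs ! k)\<close>.\<close>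

lemma op_mat_mult:
  assumes bs: "is_basis_list U bs" and cs: "is_basis_list V cs"
    and f: "Vector_Spaces.linear fscale fscale f" "f ` V \<subseteq> U"
    and g: "\<And>j. j < length ds \<Longrightarrow> g (ds ! j) \<in> V"
  shows "op_mat bs ds (\<lambda>v. f (g v)) = op_mat bs cs f * op_mat cs ds g"
proof (rule eq_matI)
  interpret f: Vector_Spaces.linear fscale fscale f by fact
  fix i j assume "i < dim_row (op_mat bs cs f * op_mat cs ds g)"
    "j < dim_col (op_mat bs cs f * op_mat cs ds g)"
  then have ij: "i < length bs" "j < length ds"
    by (simp_all add: op_mat_def)
  let ?rep = "\<lambda>v. fvs.representation (set bs) v (bs ! i)"
  let ?c = "\<lambda>k. fvs.representation (set cs) (g (ds ! j)) (cs ! k)"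
  have mem: "f (cs ! k) \<in> fvs.span (set bs)" if "k < length cs" for k
    using is_basis_list_nth[OF cs that] f(2) bs by (auto simp: is_basis_list_def)
  have ind: "fvs.independent (set bs)"
    using bs by (simp add: is_basis_list_def)
  have "f (g (ds ! j)) = (\<Sum>k<length cs. fscale (?c k) (f (cs ! k)))"
    by (subst basis_expansion[OF cs g[OF ij(2)]]) (simp add: f.sum f.scale)
  then have "?rep (f (g (ds ! j))) = (\<Sum>k<length cs. ?c k * ?rep (f (cs ! k)))"
    using mem by (simp, subst fvs.representation_sum[OF ind])
      (auto simp: fvs.representation_scale[OF ind] intro!: fvs.span_scale)
  then show "op_mat bs ds (\<lambda>v. f (g v)) $$ (i, j) = (op_mat bs cs f * op_mat cs ds g) $$ (i, j)"
    using ij by (simp add: op_mat_def scalar_prod_def mult.commute atLeast0LessThan)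
qed (simp_all add: op_mat_def)

lemma op_mat_cong:
  "(\<And>j. j < length cs \<Longrightarrow> f (cs ! j) = g (cs ! j)) \<Longrightarrow> op_mat bs cs f = op_mat bs cs g"
  by (auto simp: op_mat_def intro!: eq_matI)

lemma op_mat_id: "is_basis_list V bs \<Longrightarrow> op_mat bs bs (\<lambda>v. v) = 1\<^sub>m (length bs)"
  by (rule eq_matI) (auto simp: op_mat_def representation_nth)

lemma op_mat_scale:
  assumes "is_basis_list V bs" "\<And>j. j < length cs \<Longrightarrow> f (cs ! j) \<in> V"
  shows "op_mat bs cs (\<lambda>v. fscale a (f v)) = a \<cdot>\<^sub>m op_mat bs cs f"
  using assms by (intro eq_matI) (auto simp: op_mat_def is_basis_list_def fvs.representation_scale)

lemma op_det_scalar: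
  assumes "\<exists>bs. is_basis_list V bs" "\<And>v. v \<in> V \<Longrightarrow> T v = fscale a v"
  shows "op_det V T = a ^ fvs.dim V"
proof -
  obtain bs where bs: "is_basis_list V bs" "\<And>T. op_det V T = det (op_mat bs bs T)"
    using op_det_basis[OF assms(1)] by blast
  note nth = is_basis_list_nth[OF bs(1)]
  have "op_mat bs bs T = op_mat bs bs (\<lambda>v. fscale a v)"
    using assms(2) nth by (intro op_mat_cong) auto
  also have "\<dots> = a \<cdot>\<^sub>m 1\<^sub>m (length bs)"
    using op_mat_scale[of V bs bs "\<lambda>v. v" a] op_mat_id[OF bs(1)] bs(1) nth by simp
  finally show ?thesis
    using bs by (simp add: is_basis_list_length)
qed

lemma linear_dim_le:
  assumes U: "\<exists>bs. is_basis_list U bs" and V: "\<exists>bs. is_basis_list V bs"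
    and f: "Vector_Spaces.linear fscale fscale f" "f ` U \<subseteq> V" "inj_on f U"
  shows "fvs.dim U \<le> fvs.dim V"
proof -
  interpret f: Vector_Spaces.linear fscale fscale f by fact
  obtain bs cs where bs: "is_basis_list U bs" and cs: "is_basis_list V cs"
    using U V by blast
  have *: "fvs.independent (set bs)" "fvs.span (set bs) = U" "set bs \<subseteq> U"
    using bs fvs.span_superset by (auto simp: is_basis_list_def)
  have "fvs.independent (f ` set bs)"
    using * f(3) by (intro f.independent_injective_image) auto
  moreover have "f ` set bs \<subseteq> fvs.span (set cs)"
    using * f(2) cs by (auto simp: is_basis_list_def)
  ultimately have "card (f ` set bs) \<le> card (set cs)"
    using fvs.independent_span_bound by blast
  moreover have "card (f ` set bs) = card (set bs)"
    using * f(3) by (intro card_image inj_on_subset[OF f(3)])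
  ultimately show ?thesis
    using bs cs is_basis_list_length[OF bs] is_basis_list_length[OF cs]
    by (simp add: is_basis_list_def distinct_card)
qed

text \<open>Intertwining becomes the matrix identity T F = a F S, where F is the square matrix of
  \<open>f\<close>. Since \<open>g\<close> inverts \<open>f\<close>, det F is nonzero and cancels,
  leaving \<open>a\<close> to the power of the dimension. The premises on \<open>S\<close> and
  \<open>T\<close> sit inside the second conclusion, so that the first can be used before any
  operators are chosen.\<close>

lemma op_det_intertwine:
  assumes U: "\<exists>bs. is_basis_list U bs" and V: "\<exists>bs. is_basis_list V bs"
    and f: "Vector_Spaces.linear fscale fscale f" "f ` U \<subseteq> V"
    and g: "Vector_Spaces.linear fscale fscale g" "g ` V \<subseteq> U"
    and gf: "\<And>u. u \<in> U \<Longrightarrow> g (f u) = u" and fg: "\<And>v. v \<in> V \<Longrightarrow> f (g v) = v"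
  shows "fvs.dim U = fvs.dim V"
    and "Vector_Spaces.linear fscale fscale S \<Longrightarrow> S ` U \<subseteq> U \<Longrightarrow>
      Vector_Spaces.linear fscale fscale T \<Longrightarrow> T ` V \<subseteq> V \<Longrightarrow>
      (\<And>u. u \<in> U \<Longrightarrow> T (f u) = fscale a (f (S u))) \<Longrightarrow>
      op_det V T = a ^ fvs.dim U * op_det U S"
proof -
  have "inj_on f U" "inj_on g V"
    using gf fg by (metis inj_onI)+
  then show dim: "fvs.dim U = fvs.dim V"
    by (intro antisym linear_dim_le[OF U V f] linear_dim_le[OF V U g])
  assume S: "Vector_Spaces.linear fscale fscale S" "S ` U \<subseteq> U"
    and T: "Vector_Spaces.linear fscale fscale T" "T ` V \<subseteq> V"
    and tw: "\<And>u. u \<in> U \<Longrightarrow> T (f u) = fscale a (f (S u))"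
  obtain bs where bs: "is_basis_list U bs" "\<And>T. op_det U T = det (op_mat bs bs T)"
    using op_det_basis[OF U] by blast
  obtain cs where cs: "is_basis_list V cs" "\<And>T. op_det V T = det (op_mat cs cs T)"
    using op_det_basis[OF V] by blast
  note nb = is_basis_list_nth[OF bs(1)]
  define d where "d = length bs"
  have d: "length bs = d" "length cs = d" "fvs.dim U = d"
    using is_basis_list_length[OF bs(1)] is_basis_list_length[OF cs(1)] dim by (simp_all add: d_def)
  have car: "op_mat cs bs f \<in> carrier_mat d d" "op_mat bs cs g \<in> carrier_mat d d"
    "op_mat cs cs T \<in> carrier_mat d d" "op_mat bs bs S \<in> carrier_mat d d"
    by (simp_all add: op_mat_def d)
  have "op_mat bs cs g * op_mat cs bs f = op_mat bs bs (\<lambda>v. g (f v))"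
    using f g nb by (intro op_mat_mult[symmetric, OF bs(1) cs(1)]) auto
  also have "\<dots> = op_mat bs bs (\<lambda>v. v)"
    using gf nb by (auto intro: op_mat_cong)
  also have "\<dots> = 1\<^sub>m d"
    using op_mat_id[OF bs(1)] d by simp
  finally have "det (op_mat bs cs g) * det (op_mat cs bs f) = 1"
    using det_mult[OF car(2,1)] by simp
  then have nz: "det (op_mat cs bs f) \<noteq> 0"
    by auto
  have "op_mat cs cs T * op_mat cs bs f = op_mat cs bs (\<lambda>v. T (f v))"
    using f T nb by (intro op_mat_mult[symmetric, OF cs(1) cs(1)]) auto
  also have "\<dots> = op_mat cs bs (\<lambda>v. fscale a (f (S v)))"
    using tw nb by (auto intro: op_mat_cong)
  also have "\<dots> = a \<cdot>\<^sub>m op_mat cs bs (\<lambda>v. f (S v))"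
    using f S nb by (intro op_mat_scale[OF cs(1)]) blast
  also have "op_mat cs bs (\<lambda>v. f (S v)) = op_mat cs bs f * op_mat bs bs S"
    using f S nb by (intro op_mat_mult[OF cs(1) bs(1)]) auto
  finally have "det (op_mat cs cs T) * det (op_mat cs bs f) =
      a ^ d * (det (op_mat cs bs f) * det (op_mat bs bs S))"
    using det_mult[OF car(3,1)] det_mult[OF car(1,4)] car by (auto simp: carrier_matD)
  then show "op_det V T = a ^ fvs.dim U * op_det U S"
    using nz by (simp add: bs(2) cs(2) d)
qed

section \<open>The groups G(n,r) and their characters\<close>

lemma carrier_wreath:
  "g \<in> carrier (wreath n r) \<longleftrightarrow>
    fst g \<in> {1..n} \<rightarrow>\<^sub>E carrier (integer_mod_group r) \<and> snd g permutes {1..n}"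
  by (cases g) (simp add: wreath_def Let_def sym_group_def)

lemma one_wreath: "\<one>\<^bsub>wreath n r\<^esub> = (\<lambda>i\<in>{1..n}. 0, id)"
  by (simp add: wreath_def Let_def)

lemma mult_wreath:
  "g \<otimes>\<^bsub>wreath n r\<^esub> h =
    (\<lambda>i\<in>{1..n}. (fst g i + fst h (inv' (snd g) i)) mod int r, snd g \<circ> snd h)"
  by (cases g; cases h) (auto simp: wreath_def Let_def)

lemma finite_wreath: "r > 0 \<Longrightarrow> finite (carrier (wreath n r))"
  by (simp add: wreath_def Let_def sym_group_def carrier_integer_mod_group finite_permutations
      finite_PiE)

lemma group_wreath:
  assumes "r > 0"
  shows "group (wreath n r)"
proof (rule groupI)
  have inv_mem: "inv' w i \<in> {1..n}" if "w permutes {1..n}" "i \<in> {1..n}" for w i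
    using permutes_in_image[OF permutes_inv[OF that(1)]] that(2) by blast
  note car = carrier_wreath carrier_integer_mod_group
  show "g \<otimes>\<^bsub>wreath n r\<^esub> h \<in> carrier (wreath n r)"
    if "g \<in> carrier (wreath n r)" "h \<in> carrier (wreath n r)" for g h
    using that assms by (auto simp: car mult_wreath permutes_compose)
  show "\<one>\<^bsub>wreath n r\<^esub> \<in> carrier (wreath n r)"
    using assms by (auto simp: car one_wreath permutes_id)
  show "g \<otimes>\<^bsub>wreath n r\<^esub> h \<otimes>\<^bsub>wreath n r\<^esub> k = g \<otimes>\<^bsub>wreath n r\<^esub> (h \<otimes>\<^bsub>wreath n r\<^esub> k)"
    if "g \<in> carrier (wreath n r)" "h \<in> carrier (wreath n r)" "k \<in> carrier (wreath n r)" for g h k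
  proof -
    have p: "snd g permutes {1..n}" "snd h permutes {1..n}"
      using that by (auto simp: carrier_wreath)
    have "inv' (snd g \<circ> snd h) = inv' (snd h) \<circ> inv' (snd g)"
      using p by (intro o_inv_distrib permutes_bij)
    then show ?thesis
      using inv_mem[OF p(1)]
      by (auto simp: mult_wreath comp_assoc mod_simps add.assoc intro!: restrict_ext)
  qed
  show "\<one>\<^bsub>wreath n r\<^esub> \<otimes>\<^bsub>wreath n r\<^esub> g = g" if "g \<in> carrier (wreath n r)" for g
    using that assms
    by (cases g) (auto simp: car one_wreath mult_wreath PiE_iff extensional_def fun_eq_iff)
  show "\<exists>h\<in>carrier (wreath n r). h \<otimes>\<^bsub>wreath n r\<^esub> g = \<one>\<^bsub>wreath n r\<^esub>"
    if "g \<in> carrier (wreath n r)" for g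
  proof
    have p: "snd g permutes {1..n}"
      using that by (auto simp: carrier_wreath)
    \<comment> \<open>The product reads the second vector through the inverse of the first
      permutation, which here is \<open>snd g\<close> itself, so the entry at \<open>i\<close> has
      to cancel \<open>fst g (snd g i)\<close>.\<close>
    let ?h = "(\<lambda>i\<in>{1..n}. (- fst g (snd g i)) mod int r, inv' (snd g))"
    show "?h \<in> carrier (wreath n r)"
      using assms p permutes_inv[OF p] by (auto simp: car)
    show "?h \<otimes>\<^bsub>wreath n r\<^esub> g = \<one>\<^bsub>wreath n r\<^esub>"
      by (auto simp: mult_wreath one_wreath inv_inv_eq[OF permutes_bij[OF p]] mod_simps
          permutes_inv_o[OF p] intro!: restrict_ext)
  qed
qed

text \<open>Here \<open>\<zeta>\<close> is any \<open>r\<close>-th root of unity; primitivity enters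
  with \<open>dim_not_dvd\<close>, where a power of \<open>\<zeta>\<close> has to be told apart from
  1.\<close>

locale wreath_irreps =
  fixes n r :: nat and \<zeta> :: complex
  assumes r_pos: "r > 0" and root: "\<zeta> ^ r = 1"
begin

abbreviation "G \<equiv> wreath n r"

sublocale group G
  using group_wreath[OF r_pos] .

lemma zeta_nz: "\<zeta> \<noteq> 0"
  using root r_pos by (auto simp: power_0_left)

text \<open>Residues are stored as integers and their sums are reduced modulo \<open>r\<close>; this
  lets \<open>\<zeta> powi\<close> ignore the reduction.\<close>

lemma powi_mod: "\<zeta> powi (k mod int r) = \<zeta> powi k"
proof -
  have "\<zeta> powi k = \<zeta> powi (int r * (k div int r) + k mod int r)"
    by simp
  also have "\<dots> = (\<zeta> powi int r) powi (k div int r) * \<zeta> powi (k mod int r)"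
    by (simp only: power_int_add[OF disjI1[OF zeta_nz]] power_int_mult)
  also have "\<dots> = \<zeta> powi (k mod int r)"
    by (simp add: root)
  finally show ?thesis ..
qed

lemma powi_sum: "finite A \<Longrightarrow> \<zeta> powi (\<Sum>i\<in>A. x i) = (\<Prod>i\<in>A. \<zeta> powi x i)"
  by (induction rule: finite_induct) (simp_all add: power_int_add zeta_nz)

lemma zeta_char_prod: "zeta_char \<zeta> m g = (\<Prod>i\<in>{1..m}. \<zeta> powi (fst g i))"
  by (cases g) (simp add: zeta_char_def powi_sum)

lemma zeta_char_nz: "zeta_char \<zeta> m g \<noteq> 0"
  by (simp add: zeta_char_prod zeta_nz)

lemma zeta_char_pow_r: "zeta_char \<zeta> m g ^ r = 1"
proof -
  have "(\<zeta> powi k) ^ r = 1" for k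
    by (metis mult.commute power_int_1_left power_int_mult power_int_of_nat root)
  then show ?thesis
    by (simp add: zeta_char_prod prod_power_distrib)
qed

text \<open>In the product, \<open>g\<close> permutes the coordinates of \<open>h\<close>, and a
  product over all coordinates does not see this.\<close>

lemma zeta_char_mult:
  assumes "g \<in> carrier G"
  shows "zeta_char \<zeta> n (g \<otimes>\<^bsub>G\<^esub> h) = zeta_char \<zeta> n g * zeta_char \<zeta> n h"
proof -
  have "inv' (snd g) permutes {1..n}"
    using assms by (simp add: carrier_wreath permutes_inv)
  then have "(\<Prod>i\<in>{1..n}. \<zeta> powi fst h (inv' (snd g) i)) = (\<Prod>i\<in>{1..n}. \<zeta> powi fst h i)"
    by (intro prod.reindex_bij_betw permutes_imp_bij)
  then show ?thesis
    by (simp add: zeta_char_prod mult_wreath powi_mod power_int_add zeta_nz prod.distrib)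
qed

section \<open>Membership in the induced representation\<close>

text \<open>An element of the Young subgroup acts on the tensor product by permuting arguments up to
  a scalar. This is the scalar, built from the \<open>k\<close>-th power of the character on the
  block with index \<open>k\<close>; \<open>young_move\<close> is the accompanying map on tuples of
  tabloids.\<close>

definition young_scalar :: "nat list list \<Rightarrow> wr \<Rightarrow> complex"
  where "young_scalar lam h =
    (\<Prod>k<r. zeta_char \<zeta> (sum_list (lam ! k)) (young_component lam h k) ^ k)"

definition young_move :: "nat list list \<Rightarrow> wr \<Rightarrow> (nat \<Rightarrow> tabloid) \<Rightarrow> nat \<Rightarrow> tabloid"
  where "young_move lam h b = (\<lambda>k.
    if k < r then tabloid_act (inv' (snd (young_component lam h k))) (b k) else b k)"

abbreviation specht_tensors :: "nat list list \<Rightarrow> ((nat \<Rightarrow> tabloid) \<Rightarrow> complex) set"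
  where "specht_tensors lam \<equiv> tensor_space {..<r} (\<lambda>k. rep_space (specht (lam ! k)))"

abbreviation W :: "nat list list \<Rightarrow> (wr \<times> (nat \<Rightarrow> tabloid) \<Rightarrow> complex) set"
  where "W lam \<equiv> rep_space (wreath_irrep \<zeta> n r lam)"

abbreviation "Y lam \<equiv> young_subgroup n r lam"

text \<open>The operator chosen by \<open>SOME\<close> in \<open>tensor_op\<close> is identified
  with an explicit one: \<open>is_tensor_op_monomial\<close> shows that a choice exists, and
  \<open>is_tensor_op_unique\<close> that all choices agree on the tensor space.\<close>

lemma tensor_act:
  assumes "F \<in> specht_tensors lam"
  shows "rep_act (ext_tensor {..<r} (\<lambda>k. ext_specht \<zeta> k (lam ! k))) (young_component lam h) F =
    (\<lambda>b. young_scalar lam h * F (young_move lam h b))"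
proof -
  let ?V = "\<lambda>k. rep_space (ext_specht \<zeta> k (lam ! k))"
  let ?T = "\<lambda>k. rep_act (ext_specht \<zeta> k (lam ! k)) (young_component lam h k)"
  have V: "?V = (\<lambda>k. rep_space (specht (lam ! k)))"
    by (simp add: ext_specht_def)
  have L: "is_tensor_op {..<r} ?V ?T (\<lambda>F b.
      (\<Prod>k\<in>{..<r}. zeta_char \<zeta> (sum_list (lam ! k)) (young_component lam h k) ^ k) *
      F (\<lambda>k. (\<lambda>k X. if k < r then tabloid_act (inv' (snd (young_component lam h k))) X else X)
        k (b k)))"
    by (rule is_tensor_op_monomial) (simp add: ext_specht_def specht_def fscale_def)
  then have "is_tensor_op {..<r} ?V ?T (tensor_op {..<r} ?V ?T)"
    unfolding tensor_op_def by (rule someI[of "is_tensor_op {..<r} ?V ?T"])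
  from is_tensor_op_unique[OF this L, of F] assms show ?thesis
    by (simp add: ext_tensor_def V young_scalar_def young_move_def)
qed

text \<open>This eliminates \<open>tensor_op\<close>: from here on the induced module is handled
  through the explicit scalar and move alone.\<close>

lemma mem_irrep:
  "F \<in> W lam \<longleftrightarrow> (\<forall>g b. g \<notin> carrier G \<longrightarrow> F (g, b) = 0) \<and>
    (\<forall>g\<in>carrier G. (\<lambda>b. F (g, b)) \<in> specht_tensors lam) \<and>
    (\<forall>h\<in>Y lam. \<forall>g\<in>carrier G. \<forall>b.
      F (h \<otimes>\<^bsub>G\<^esub> g, b) = young_scalar lam h * F (g, young_move lam h b))"
proof -
  have "rep_space (pullback_rep (young_component lam)
      (ext_tensor {..<r} (\<lambda>k. ext_specht \<zeta> k (lam ! k)))) = specht_tensors lam"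
    by (simp add: pullback_rep_def ext_tensor_def ext_specht_def)
  then show ?thesis
    using tensor_act by (auto simp: wreath_irrep_def induced_rep_def pullback_rep_def fun_eq_iff)
qed

lemma irrep_act:
  "rep_act (wreath_irrep \<zeta> n r lam) x F =
    (\<lambda>(g, b). if g \<in> carrier G then F (g \<otimes>\<^bsub>G\<^esub> x, b) else 0)"
  by (simp add: wreath_irrep_def induced_rep_def)

lemma linear_irrep_act:
  "Vector_Spaces.linear fscale fscale (rep_act (wreath_irrep \<zeta> n r lam) x)"
  unfolding Vector_Spaces.linear_iff
  by (intro conjI allI fvs.vector_space_axioms) (auto simp: irrep_act fscale_def fun_eq_iff)

text \<open>Covariance concerns left translation and the action is right translation; the two
  commute by associativity.\<close>

lemma irrep_act_closed:
  assumes "x \<in> carrier G" "F \<in> W lam"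
  shows "rep_act (wreath_irrep \<zeta> n r lam) x F \<in> W lam"
proof -
  have "h \<in> carrier G" if "h \<in> Y lam" for h
    using that by (auto simp: young_subgroup_def)
  then show ?thesis
    using assms by (auto simp: mem_irrep irrep_act m_assoc)
qed

section \<open>Finite dimension\<close>

text \<open>The elements are given in the form in which they occur as terms of a polytabloid, so
  that the supports can be read off directly.\<close>

definition tabloids :: "nat list \<Rightarrow> tabloid set"
  where "tabloids \<mu> = {tabloid_act \<pi> (tabloid_of \<mu> t) | \<pi> t.
    \<pi> permutes {1..sum_list \<mu>} \<and> is_tableau \<mu> t}"

lemma finite_cells: "finite (cells \<mu>)"
proof -
  have "cells \<mu> = Sigma {..<length \<mu>} (\<lambda>i. {..<\<mu> ! i})"
    by (auto simp: cells_def)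
  then show ?thesis
    by simp
qed

lemma finite_tabloids: "finite (tabloids \<mu>)"
proof -
  have "finite {t. is_tableau \<mu> t}"
  proof (rule finite_subset)
    show "finite {t. \<forall>c. (c \<in> cells \<mu> \<longrightarrow> t c \<in> {1..sum_list \<mu>}) \<and> (c \<notin> cells \<mu> \<longrightarrow> t c = 0)}"
      by (intro finite_set_of_finite_funs finite_cells) simp
  qed (auto simp: is_tableau_def bij_betw_def)
  moreover have "finite {\<pi>. \<pi> permutes {1..sum_list \<mu>}}"
    by (rule finite_permutations) simp
  moreover have "tabloids \<mu> = (\<lambda>(\<pi>, t). tabloid_act \<pi> (tabloid_of \<mu> t)) `
      ({\<pi>. \<pi> permutes {1..sum_list \<mu>}} \<times> {t. is_tableau \<mu> t})"
    by (auto simp: tabloids_def)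
  ultimately show ?thesis
    by simp
qed

text \<open>A polytabloid is a combination of indicators of members of
  \<open>tabloids \<mu>\<close>, and vanishing at \<open>X\<close> passes to the span.\<close>

lemma specht_support:
  assumes "f \<in> rep_space (specht \<mu>)" "X \<notin> tabloids \<mu>"
  shows "f X = 0"
proof -
  have "f \<in> fvs.span {polytabloid \<mu> t | t. is_tableau \<mu> t}"
    using assms(1) by (simp add: specht_def)
  then show ?thesis
  proof (induction rule: fvs.span_induct_alt)
    case base
    then show ?case by simp
  next
    case (step c p f)
    then obtain t where "p = polytabloid \<mu> t" "is_tableau \<mu> t"
      by blast
    then have "p X = 0"
      using assms(2) by (auto simp: polytabloid_def tabloids_def column_stabilizer_def
          intro!: sum.neutral)
    with step show ?case
      by (simp add: fscale_def)
  qed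
qed

text \<open>Tuples are functions on all naturals, hence infinite in number. Pure tensors see only
  the components below \<open>r\<close> and vanish unless each is a tabloid of the right shape, so
  finitely many values determine an element.\<close>

lemma tensor_support:
  assumes "F \<in> specht_tensors lam"
  shows "F b = (if \<forall>k<r. b k \<in> tabloids (lam ! k) then F (restrict b {..<r}) else 0)"
  using assms[unfolded tensor_space_def]
proof (induction rule: fvs.span_induct_alt)
  case base
  then show ?case by simp
next
  case (step c p F)
  then obtain v where v: "p = pure_tensor {..<r} v" "\<forall>k<r. v k \<in> rep_space (specht (lam ! k))"
    by auto
  have "p b = p (restrict b {..<r})"
    by (auto simp: v pure_tensor_def intro!: prod.cong)
  moreover have "p b = 0" if "\<not> (\<forall>k<r. b k \<in> tabloids (lam ! k))"
  proof -
    from that obtain k where "k < r" "b k \<notin> tabloids (lam ! k)"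
      by auto
    then have "\<exists>k\<in>{..<r}. v k (b k) = 0"
      using v specht_support by blast
    then show ?thesis
      by (auto simp: v pure_tensor_def)
  qed
  moreover define b' where "b' = restrict b {..<r}"
  ultimately show ?case
    using step.IH unfolding b'_def[symmetric] by (auto simp: fscale_def)
qed

lemma subspace_irrep: "fvs.subspace (W lam)"
proof -
  have "fvs.subspace (specht_tensors lam)"
    by (simp add: tensor_space_def)
  note s = this[unfolded fvs.subspace_def]
  have *: "(\<lambda>b. F (g, b) + H (g, b)) = (\<lambda>b. F (g, b)) + (\<lambda>b. H (g, b))"
    "(\<lambda>b. c * F (g, b)) = fscale c (\<lambda>b. F (g, b))" for F H :: "'x \<times> 'y \<Rightarrow> complex" and g c
    by (auto simp: fscale_def)
  show ?thesis
    unfolding fvs.subspace_def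
    using s by (auto simp: mem_irrep fscale_def[of _ "_ :: _ \<times> _ \<Rightarrow> _"] * distrib_left zero_fun_def)
qed

lemma sum_fun_apply: "sum f A x = (\<Sum>i\<in>A. f i x)"
  for f :: "'i \<Rightarrow> 'x \<Rightarrow> complex"
  by (induction A rule: infinite_finite_induct) simp_all

lemma irrep_basis: "\<exists>bs. is_basis_list (W lam) bs"
proof (rule is_basis_list_exists[OF subspace_irrep])
  let ?I = "carrier G \<times> Pi\<^sub>E {..<r} (\<lambda>k. tabloids (lam ! k))"
  \<comment> \<open>These indicators are constant in the components of \<open>b\<close> from
    \<open>r\<close> on, as the elements of the module are. They need not lie in
    \<open>W lam\<close>; they only have to span a space containing it.\<close>
  let ?e = "\<lambda>i (g, b). if (g, restrict b {..<r}) = i then 1 else (0 :: complex)"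
  show "finite (?e ` ?I)"
    by (intro finite_imageI finite_cartesian_product finite_PiE finite_wreath r_pos finite_tabloids)
      simp
  have finI: "finite ?I"
    by (intro finite_cartesian_product finite_PiE finite_wreath r_pos finite_tabloids) simp
  show "W lam \<subseteq> fvs.span (?e ` ?I)"
  proof
    fix F assume F: "F \<in> W lam"
    have "F = (\<Sum>i\<in>?I. fscale (F i) (?e i))"
    proof (rule ext, clarify)
      fix g b
      have "(\<Sum>i\<in>?I. fscale (F i) (?e i)) (g, b) = (\<Sum>i\<in>?I. F i * ?e i (g, b))"
        by (subst sum_fun_apply) (simp add: fscale_def)
      also have "\<dots> = (\<Sum>i\<in>?I. if i = (g, restrict b {..<r}) then F i else 0)"
        by (intro sum.cong) auto
      also have "\<dots> = F (g, b)"
      proof -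
        define b' where "b' = restrict b {..<r}"
        have "(g, b') \<in> ?I \<longleftrightarrow> g \<in> carrier G \<and> (\<forall>k<r. b k \<in> tabloids (lam ! k))"
          by (auto simp: b'_def)
        moreover have "F (g, b) = 0" if "g \<notin> carrier G"
          using F that unfolding mem_irrep by blast
        moreover have "F (g, b) = (if \<forall>k<r. b k \<in> tabloids (lam ! k) then F (g, b') else 0)"
          if "g \<in> carrier G"
          using F that tensor_support[of "\<lambda>b. F (g, b)" lam b] unfolding mem_irrep b'_def by blast
        ultimately show ?thesis
          unfolding sum.delta[OF finI] b'_def[symmetric]
          by (cases "g \<in> carrier G"; cases "\<forall>k<r. b k \<in> tabloids (lam ! k)")
            (simp_all only: simp_thms if_True if_False)
      qed
      finally show "F (g, b) = (\<Sum>i\<in>?I. fscale (F i) (?e i)) (g, b)" ..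
    qed
    also have "\<dots> \<in> fvs.span (?e ` ?I)"
      by (intro fvs.span_sum fvs.span_scale fvs.span_base imageI)
    finally show "F \<in> fvs.span (?e ` ?I)" .
  qed
qed

end

context wreath_irreps
begin

section \<open>Permuting the blocks\<close>

definition perm_elt :: "(nat \<Rightarrow> nat) \<Rightarrow> wr"
  where "perm_elt \<sigma> = (\<lambda>i\<in>{1..n}. 0, \<sigma>)"

lemma perm_elt_carrier: "\<sigma> permutes {1..n} \<Longrightarrow> perm_elt \<sigma> \<in> carrier G"
  using r_pos by (auto simp: perm_elt_def carrier_wreath carrier_integer_mod_group)

lemma zeta_char_perm_elt: "zeta_char \<zeta> n (perm_elt \<sigma>) = 1"
  by (simp add: zeta_char_prod perm_elt_def)

lemma inv_perm_elt:
  assumes "\<sigma> permutes {1..n}"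
  shows "inv\<^bsub>G\<^esub> (perm_elt \<sigma>) = perm_elt (inv' \<sigma>)"
proof (rule inv_equality)
  have "inv' (inv' \<sigma>) i \<in> {1..n} \<longleftrightarrow> i \<in> {1..n}" for i
    using permutes_in_image[OF permutes_inv[OF permutes_inv[OF assms]]] .
  then show "perm_elt (inv' \<sigma>) \<otimes>\<^bsub>G\<^esub> perm_elt \<sigma> = \<one>\<^bsub>G\<^esub>"
    unfolding mult_wreath one_wreath perm_elt_def fst_conv snd_conv permutes_inv_o(2)[OF assms]
    by (intro arg_cong2[of _ _ _ _ Pair] restrict_ext refl) (simp only: restrict_apply' add_0 mod_0)
qed (use assms permutes_inv perm_elt_carrier in auto)

lemma conj_perm_elt:
  assumes \<sigma>: "\<sigma> permutes {1..n}" and g: "g \<in> carrier G"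
  shows "perm_elt \<sigma> \<otimes>\<^bsub>G\<^esub> g \<otimes>\<^bsub>G\<^esub> inv\<^bsub>G\<^esub> (perm_elt \<sigma>) =
    (\<lambda>i\<in>{1..n}. fst g (inv' \<sigma> i), \<sigma> \<circ> snd g \<circ> inv' \<sigma>)"
proof -
  have *: "inv' \<sigma> i \<in> {1..n}" "inv' (\<sigma> \<circ> snd g) i \<in> {1..n}" if "i \<in> {1..n}" for i
    using permutes_in_image[OF permutes_inv[OF \<sigma>]] that
      permutes_in_image[OF permutes_inv[OF permutes_compose[OF _ \<sigma>]], of "snd g"] g
    by (auto simp: carrier_wreath)
  \<comment> \<open>Entries of group elements are already reduced, so the reductions made by the two
    multiplications disappear.\<close>
  have "fst g (inv' \<sigma> i) mod int r = fst g (inv' \<sigma> i)" if "i \<in> {1..n}" for i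
    using g *(1)[OF that] r_pos by (auto simp: carrier_wreath carrier_integer_mod_group PiE_iff)
  then show ?thesis
    unfolding inv_perm_elt[OF \<sigma>]
    using * by (auto simp: mult_wreath perm_elt_def intro!: restrict_ext)
qed

text \<open>\<open>\<sigma>\<close> moves the blocks of \<open>lam\<close> by translations onto those of \<open>lam'\<close>, and \<open>c\<close> records the
  resulting permutation of the block indices.\<close>

definition block_match ::
  "nat list list \<Rightarrow> nat list list \<Rightarrow> (nat \<Rightarrow> nat) \<Rightarrow> (nat \<Rightarrow> nat) \<Rightarrow> bool"
  where "block_match lam lam' \<sigma> c \<longleftrightarrow> \<sigma> permutes {1..n} \<and> c permutes {..<r} \<and>
    (\<forall>k<r. lam' ! k = lam ! c k \<and> (\<forall>i\<in>{1..sum_list (lam' ! k)}.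
      block_start lam (c k) + i \<in> {1..n} \<and> \<sigma> (block_start lam (c k) + i) = block_start lam' k + i))"

text \<open>This allows the inverse intertwiner to be obtained from the same construction with
  \<open>lam\<close> and \<open>lam'\<close> exchanged.\<close>

lemma block_match_sym:
  assumes "block_match lam lam' \<sigma> c"
  shows "block_match lam' lam (inv' \<sigma>) (inv' c)"
proof -
  have p: "\<sigma> permutes {1..n}" "c permutes {..<r}"
    using assms by (auto simp: block_match_def)
  have k: "inv' c k < r" "c (inv' c k) = k" if "k < r" for k
    using permutes_in_image[OF permutes_inv[OF p(2)], of k] that permutes_inverses[OF p(2)] by auto
  have "lam ! k = lam' ! inv' c k" if "k < r" for k
    using assms k[OF that] by (auto simp: block_match_def)
  moreover have "block_start lam' (inv' c k) + i \<in> {1..n}"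
    "inv' \<sigma> (block_start lam' (inv' c k) + i) = block_start lam k + i"
    if "k < r" "i \<in> {1..sum_list (lam ! k)}" for k i
  proof -
    have "block_start lam k + i \<in> {1..n}"
      "\<sigma> (block_start lam k + i) = block_start lam' (inv' c k) + i"
      using assms k[OF that(1)] that by (auto simp: block_match_def)
    then show "block_start lam' (inv' c k) + i \<in> {1..n}"
      "inv' \<sigma> (block_start lam' (inv' c k) + i) = block_start lam k + i"
      using permutes_in_image[OF p(1), of "block_start lam k + i"] permutes_inverses[OF p(1)]
      by metis+
  qed
  ultimately show ?thesis
    using p by (auto simp: block_match_def permutes_inv)
qed

lemma block_image:
  "block lam k = (\<lambda>i. block_start lam k + i) ` {1..sum_list (lam ! k)}"
  by (simp add: block_def add.commute)

lemma mem_young: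
  "h \<in> Y lam \<longleftrightarrow> h \<in> carrier G \<and> (\<forall>k<r. snd h ` block lam k = block lam k)"
  by (cases h) (simp add: young_subgroup_def)

lemma young_component_alt:
  "young_component lam h k =
    (\<lambda>i\<in>{1..sum_list (lam ! k)}. fst h (block_start lam k + i),
     \<lambda>i. if i \<in> {1..sum_list (lam ! k)}
       then snd h (block_start lam k + i) - block_start lam k else i)"
  by (simp add: young_component_def case_prod_beta)

text \<open>Because \<open>\<sigma>\<close> carries blocks to blocks by translations, conjugation
  moves the component of \<open>h\<close> on a block unchanged to the matching block; only the block
  index changes, by \<open>c\<close>.\<close>

lemma young_conj:
  assumes m: "block_match lam lam' \<sigma> c" and h: "h \<in> Y lam"
  defines "h' \<equiv> perm_elt \<sigma> \<otimes>\<^bsub>G\<^esub> h \<otimes>\<^bsub>G\<^esub> inv\<^bsub>G\<^esub> (perm_elt \<sigma>)"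
  shows "h' \<in> Y lam'"
    and "k < r \<Longrightarrow> young_component lam' h' k = young_component lam h (c k)"
proof -
  have \<sigma>: "\<sigma> permutes {1..n}" and c: "c permutes {..<r}"
    using m by (auto simp: block_match_def)
  have hG: "h \<in> carrier G"
    using h by (simp add: mem_young)
  have h'G: "h' \<in> carrier G"
    unfolding h'_def using hG perm_elt_carrier[OF \<sigma>] by simp
  note h' = conj_perm_elt[OF \<sigma> hG, folded h'_def]
  have c_lt: "c k < r" if "k < r" for k
    using permutes_in_image[OF c, of k] that by simp
  have len: "lam' ! k = lam ! c k" if "k < r" for k
    using m that by (auto simp: block_match_def)
  have pos: "block_start lam (c k) + i \<in> {1..n}"
    "\<sigma> (block_start lam (c k) + i) = block_start lam' k + i"
    "inv' \<sigma> (block_start lam' k + i) = block_start lam (c k) + i"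
    "block_start lam' k + i \<in> {1..n}"
    if "k < r" "i \<in> {1..sum_list (lam ! c k)}" for k i
  proof -
    show *: "block_start lam (c k) + i \<in> {1..n}"
      "\<sigma> (block_start lam (c k) + i) = block_start lam' k + i"
      using m that by (auto simp: block_match_def)
    then show "inv' \<sigma> (block_start lam' k + i) = block_start lam (c k) + i"
      "block_start lam' k + i \<in> {1..n}"
      using permutes_in_image[OF \<sigma>, of "block_start lam (c k) + i"] permutes_inverses[OF \<sigma>]
      by metis+
  qed
  have img: "\<sigma> ` block lam (c k) = block lam' k" if "k < r" for k
    unfolding block_image image_image len[OF that] by (intro image_cong refl pos(2)[OF that])
  have hb: "snd h ` block lam (c k) = block lam (c k)" if "k < r" for k
    using h c_lt[OF that] by (simp add: mem_young)
  have "snd h' ` block lam' k = block lam' k" if "k < r" for k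
  proof -
    have "inv' \<sigma> ` block lam' k = block lam (c k)"
      using img[OF that] permutes_inj[OF \<sigma>] by (metis image_inv_f_f)
    then show ?thesis
      by (simp only: h' snd_conv image_comp[symmetric] hb[OF that] img[OF that])
  qed
  then show "h' \<in> Y lam'"
    using h'G by (simp add: mem_young)
  assume k: "k < r"
  \<comment> \<open>Since \<open>h\<close> preserves the block, its images have the form start plus
    \<open>j\<close>, so the truncated subtraction in \<open>young_component\<close> is
    exact.\<close>
  have ex: "\<exists>j\<in>{1..sum_list (lam ! c k)}.
      snd h (block_start lam (c k) + i) = block_start lam (c k) + j"
    if "i \<in> {1..sum_list (lam ! c k)}" for i
  proof -
    have "block_start lam (c k) + i \<in> block lam (c k)"
      using that by (auto simp: block_def)
    then have "snd h (block_start lam (c k) + i) \<in> block lam (c k)"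
      using hb[OF k] by blast
    then show ?thesis
      unfolding block_image by blast
  qed
  have eq: "fst h' (block_start lam' k + i) = fst h (block_start lam (c k) + i)"
    "snd h' (block_start lam' k + i) - block_start lam' k =
      snd h (block_start lam (c k) + i) - block_start lam (c k)"
    if i: "i \<in> {1..sum_list (lam ! c k)}" for i
  proof -
    obtain j where j: "j \<in> {1..sum_list (lam ! c k)}"
      "snd h (block_start lam (c k) + i) = block_start lam (c k) + j"
      using ex[OF i] by blast
    show "fst h' (block_start lam' k + i) = fst h (block_start lam (c k) + i)"
      by (simp only: h' fst_conv restrict_apply' pos(3,4)[OF k i])
    show "snd h' (block_start lam' k + i) - block_start lam' k =
        snd h (block_start lam (c k) + i) - block_start lam (c k)"
      by (simp only: h' snd_conv comp_apply pos(3)[OF k i] j(2) pos(2)[OF k j(1)] diff_add_inverse)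
  qed
  show "young_component lam' h' k = young_component lam h (c k)"
    unfolding young_component_alt len[OF k]
    by (intro arg_cong2[of _ _ _ _ Pair] restrict_ext ext) (simp_all only: eq cong: if_cong)
qed

text \<open>Precomposition with \<open>c\<close> reorders tensor factors: the pure tensor of
  \<open>v\<close> becomes that of \<open>v \<circ> inv' c\<close>.\<close>

lemma tensor_reindex:
  assumes c: "c permutes {..<r}" and lam: "\<And>k. k < r \<Longrightarrow> lam' ! k = lam ! c k"
    and F: "F \<in> specht_tensors lam'"
  shows "(\<lambda>b. F (b \<circ> c)) \<in> specht_tensors lam"
  using F unfolding tensor_space_def
proof (induction rule: fvs.span_induct_alt)
  case base
  have "(\<lambda>b. 0 (b \<circ> c)) = (0 :: (nat \<Rightarrow> tabloid) \<Rightarrow> complex)"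
    by (simp add: fun_eq_iff)
  then show ?case
    by (simp only: fvs.span_zero)
next
  case (step a p F)
  then obtain v where v: "p = pure_tensor {..<r} v" "\<forall>k<r. v k \<in> rep_space (specht (lam' ! k))"
    by auto
  have c_inv: "inv' c k < r" "c (inv' c k) = k" if "k < r" for k
    using permutes_in_image[OF permutes_inv[OF c], of k] that permutes_inverses[OF c] by auto
  have "p (b \<circ> c) = pure_tensor {..<r} (v \<circ> inv' c) b" for b
  proof -
    have "(\<Prod>k<r. v (inv' c (c k)) (b (c k))) = (\<Prod>k<r. v (inv' c k) (b k))"
      by (rule prod.reindex_bij_betw[OF permutes_imp_bij[OF c]])
    then show ?thesis
      by (simp add: v pure_tensor_def permutes_inverses[OF c])
  qed
  moreover have "\<forall>k<r. (v \<circ> inv' c) k \<in> rep_space (specht (lam ! k))"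
    using v(2) lam c_inv by (metis comp_apply)
  ultimately have "(\<lambda>b. p (b \<circ> c)) \<in>
      {pure_tensor {..<r} v | v. \<forall>k\<in>{..<r}. v k \<in> rep_space (specht (lam ! k))}"
    by auto
  then have mem: "fscale a (\<lambda>b. p (b \<circ> c)) + (\<lambda>b. F (b \<circ> c)) \<in> fvs.span
      {pure_tensor {..<r} v | v. \<forall>k\<in>{..<r}. v k \<in> rep_space (specht (lam ! k))}"
    by (intro fvs.span_add[OF fvs.span_scale[OF fvs.span_base] step.IH])
  have eq: "fscale a (\<lambda>b. p (b \<circ> c)) + (\<lambda>b. F (b \<circ> c)) = (\<lambda>b. (fscale a p + F) (b \<circ> c))"
    by (simp add: fun_eq_iff fscale_def)
  show ?case
    using mem unfolding eq .
qed

text \<open>Left translation by a permutation identifies modules induced from conjugate subgroups,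
  and precomposition with \<open>c\<close> reorders the tensor factors to match. Multiplying by a
  character \<open>\<theta>\<close> turns the module induced from a twisted representation into a
  twist of the induced module.\<close>

definition twist :: "(nat \<Rightarrow> nat) \<Rightarrow> (nat \<Rightarrow> nat) \<Rightarrow> (wr \<Rightarrow> complex) \<Rightarrow>
    (wr \<times> (nat \<Rightarrow> tabloid) \<Rightarrow> complex) \<Rightarrow> (wr \<times> (nat \<Rightarrow> tabloid) \<Rightarrow> complex)"
  where "twist \<sigma> c \<theta> F =
    (\<lambda>(g, b). if g \<in> carrier G then \<theta> g * F (perm_elt \<sigma> \<otimes>\<^bsub>G\<^esub> g, b \<circ> c) else 0)"

lemma linear_twist: "Vector_Spaces.linear fscale fscale (twist \<sigma> c \<theta>)"
  unfolding Vector_Spaces.linear_iff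
  by (intro conjI allI fvs.vector_space_axioms)
    (auto simp: twist_def fscale_def fun_eq_iff algebra_simps)

text \<open>If \<open>h'\<close> is the conjugate of \<open>h\<close> by \<open>\<sigma>\<close>,
  then \<sigma>(hg) = h'(\<sigma>g), so covariance of \<open>F\<close> under \<open>h'\<close>
  yields covariance of the twist under \<open>h\<close>. The tuples move alike by
  \<open>young_conj\<close>, and \<open>\<theta> h\<close> makes up for the difference of the
  scalars.\<close>

lemma twist_mem:
  assumes m: "block_match lam lam' \<sigma> c"
    and \<theta>: "\<And>g h. g \<in> carrier G \<Longrightarrow> h \<in> carrier G \<Longrightarrow> \<theta> (g \<otimes>\<^bsub>G\<^esub> h) = \<theta> g * \<theta> h"
    and scalar: "\<And>h. h \<in> Y lam \<Longrightarrow>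
      young_scalar lam' (perm_elt \<sigma> \<otimes>\<^bsub>G\<^esub> h \<otimes>\<^bsub>G\<^esub> inv\<^bsub>G\<^esub> (perm_elt \<sigma>)) * \<theta> h = young_scalar lam h"
    and F: "F \<in> W lam'"
  shows "twist \<sigma> c \<theta> F \<in> W lam"
  unfolding mem_irrep
proof (intro conjI allI ballI impI)
  have \<sigma>: "\<sigma> permutes {1..n}" and c: "c permutes {..<r}"
    and lam: "\<And>k. k < r \<Longrightarrow> lam' ! k = lam ! c k"
    using m by (auto simp: block_match_def)
  note s = perm_elt_carrier[OF \<sigma>]
  have F_tensor: "(\<lambda>b. F (g, b)) \<in> specht_tensors lam'" if "g \<in> carrier G" for g
    using F that by (auto simp: mem_irrep)
  have F_young: "F (h \<otimes>\<^bsub>G\<^esub> g, b) = young_scalar lam' h * F (g, young_move lam' h b)"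
    if "h \<in> Y lam'" "g \<in> carrier G" for g h b
    using F that unfolding mem_irrep by blast
  show "twist \<sigma> c \<theta> F (g, b) = 0" if "g \<notin> carrier G" for g b
    using that by (simp add: twist_def)
  show "(\<lambda>b. twist \<sigma> c \<theta> F (g, b)) \<in> specht_tensors lam" if "g \<in> carrier G" for g
  proof -
    have "(\<lambda>b. F (perm_elt \<sigma> \<otimes>\<^bsub>G\<^esub> g, b \<circ> c)) \<in> specht_tensors lam"
      using tensor_reindex[OF c lam F_tensor] that s by simp
    then have "fscale (\<theta> g) (\<lambda>b. F (perm_elt \<sigma> \<otimes>\<^bsub>G\<^esub> g, b \<circ> c)) \<in> specht_tensors lam"
      by (simp add: tensor_space_def fvs.span_scale)
    then show ?thesis
      using that by (simp add: twist_def fscale_def)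
  qed
  fix h g b
  assume h: "h \<in> Y lam" and g: "g \<in> carrier G"
  define h' where "h' = perm_elt \<sigma> \<otimes>\<^bsub>G\<^esub> h \<otimes>\<^bsub>G\<^esub> inv\<^bsub>G\<^esub> (perm_elt \<sigma>)"
  have hG: "h \<in> carrier G"
    using h by (simp add: mem_young)
  have h': "h' \<in> Y lam'" "\<And>k. k < r \<Longrightarrow> young_component lam' h' k = young_component lam h (c k)"
    using young_conj[OF m h] by (simp_all add: h'_def)
  have h'G: "h' \<in> carrier G"
    using h'(1) by (simp add: mem_young)
  have "perm_elt \<sigma> \<otimes>\<^bsub>G\<^esub> (h \<otimes>\<^bsub>G\<^esub> g) = h' \<otimes>\<^bsub>G\<^esub> (perm_elt \<sigma> \<otimes>\<^bsub>G\<^esub> g)"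
    using s hG g by (simp add: h'_def m_assoc) (simp flip: m_assoc)
  moreover have "young_move lam' h' (b \<circ> c) = young_move lam h b \<circ> c"
  proof
    fix k
    show "young_move lam' h' (b \<circ> c) k = (young_move lam h b \<circ> c) k"
      using h'(2)[of k] permutes_in_image[OF c, of k] by (simp add: young_move_def)
  qed
  moreover have "young_scalar lam' h' * \<theta> h = young_scalar lam h"
    using scalar[OF h] by (simp add: h'_def)
  ultimately show "twist \<sigma> c \<theta> F (h \<otimes>\<^bsub>G\<^esub> g, b) =
      young_scalar lam h * twist \<sigma> c \<theta> F (g, young_move lam h b)"
    using h'(1) hG g s by (simp add: twist_def F_young \<theta> flip: \<open>_ = young_scalar lam h\<close>)
qed

text \<open>The translations and the reorderings cancel. As \<open>\<theta>\<close> is 1 on the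
  permutation, translating its argument does not change it, and what remains is the factor
  \<open>\<theta>' g * \<theta> g = 1\<close>.\<close>

lemma twist_twist:
  assumes "\<sigma> permutes {1..n}" "c permutes {..<r}"
    and \<theta>: "\<And>g h. g \<in> carrier G \<Longrightarrow> \<theta> (g \<otimes>\<^bsub>G\<^esub> h) = \<theta> g * \<theta> h"
    and one: "\<theta> (perm_elt (inv' \<sigma>)) = 1"
    and inv: "\<And>g. g \<in> carrier G \<Longrightarrow> \<theta>' g * \<theta> g = 1"
    and F: "F \<in> W lam"
  shows "twist (inv' \<sigma>) (inv' c) \<theta>' (twist \<sigma> c \<theta> F) = F"
proof (rule ext, clarify)
  fix x w and b :: "nat \<Rightarrow> tabloid"
  have s: "perm_elt \<sigma> \<in> carrier G" "perm_elt (inv' \<sigma>) \<in> carrier G"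
    using perm_elt_carrier permutes_inv[OF assms(1)] assms(1) by auto
  have "perm_elt \<sigma> \<otimes>\<^bsub>G\<^esub> (perm_elt (inv' \<sigma>) \<otimes>\<^bsub>G\<^esub> g) = g" if "g \<in> carrier G" for g
    using s that by (simp flip: m_assoc inv_perm_elt[OF assms(1)])
  moreover have "b \<circ> inv' c \<circ> c = b"
    using permutes_inv_o(2)[OF assms(2)] by (simp add: comp_assoc)
  moreover have "F ((x, w), b) = 0" if "(x, w) \<notin> carrier G"
    using F that by (simp add: mem_irrep)
  moreover have "\<theta> (perm_elt (inv' \<sigma>) \<otimes>\<^bsub>G\<^esub> (x, w)) = \<theta> (x, w)"
    using \<theta>[OF s(2)] one by simp
  ultimately show "twist (inv' \<sigma>) (inv' c) \<theta>' (twist \<sigma> c \<theta> F) ((x, w), b) = F ((x, w), b)"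
    using s inv[of "(x, w)"] by (simp add: twist_def flip: mult.assoc)
qed

end

section \<open>Products over consecutive blocks; rotation and finiteness of multipartitions\<close>

lemma prod_blocks:
  fixes f :: "nat \<Rightarrow> 'a :: comm_monoid_mult" and a :: "nat \<Rightarrow> nat"
  shows "(\<Prod>i\<in>{1..\<Sum>k<m. a k}. f i) = (\<Prod>k<m. \<Prod>i\<in>{1..a k}. f ((\<Sum>j<k. a j) + i))"
proof (induction m)
  case (Suc m)
  let ?s = "\<Sum>k<m. a k"
  have "{1..?s + a m} = {1..?s} \<union> {?s + 1..?s + a m}"
    by auto
  then have "(\<Prod>i\<in>{1..?s + a m}. f i) = (\<Prod>i\<in>{1..?s}. f i) * (\<Prod>i\<in>{?s + 1..?s + a m}. f i)"
    by (simp add: prod.union_disjoint)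
  also have "(\<Prod>i\<in>{?s + 1..?s + a m}. f i) = (\<Prod>i\<in>{1..a m}. f (?s + i))"
    using prod.shift_bounds_cl_nat_ivl[of f 1 ?s "a m"] by (simp add: add.commute)
  finally show ?case
    using Suc.IH by simp
qed simp

lemma power_eq_power_mod:
  fixes z :: "'a :: monoid_mult"
  assumes "z ^ r = 1"
  shows "z ^ k = z ^ (k mod r)"
proof -
  have "z ^ k = z ^ (r * (k div r) + k mod r)"
    by simp
  also have "\<dots> = z ^ (k mod r)"
    by (simp only: power_add power_mult assms power_one mult_1_left)
  finally show ?thesis .
qed

lemma multipartitions_rotate1:
  assumes "lam \<in> multipartitions n r"
  shows "rotate1 lam \<in> multipartitions n r"
proof -
  have *: "(\<Sum>k<length l. sum_list (l ! k)) = sum_list (map sum_list l)" for l :: "nat list list"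
    by (simp add: sum_list_sum_nth atLeast0LessThan)
  have "sum_list (map sum_list (rotate1 lam)) = sum_list (map sum_list lam)"
    by (cases lam) simp_all
  then show ?thesis
    using assms by (auto simp: multipartitions_def simp flip: *)
qed

lemma finite_multipartitions: "finite (multipartitions n r)"
proof -
  let ?P = "{\<mu> :: nat list. set \<mu> \<subseteq> {..n} \<and> length \<mu> \<le> n}"
  have "\<mu> \<in> ?P" if lam: "lam \<in> multipartitions n r" and \<mu>: "\<mu> \<in> set lam" for lam \<mu>
  proof -
    obtain k where k: "k < r" "\<mu> = lam ! k"
      using lam \<mu> unfolding multipartitions_def in_set_conv_nth by blast
    have "sum_list (lam ! k) \<le> (\<Sum>k<r. sum_list (lam ! k))"
      using k by (intro member_le_sum) auto
    then have sum: "sum_list \<mu> \<le> n"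
      using lam k by (simp add: multipartitions_def)
    \<comment> \<open>All parts are positive, so the size of a partition bounds its length as well
      as its entries.\<close>
    have "length \<mu> \<le> sum_list \<mu>" if "0 \<notin> set \<mu>" for \<mu> :: "nat list"
      using that by (induction \<mu>) auto
    then have "length \<mu> \<le> n"
      using lam \<mu> sum by (auto simp: multipartitions_def is_partition_def intro: order_trans)
    moreover have "set \<mu> \<subseteq> {..n}"
      using sum member_le_sum_list[of _ \<mu>] by fastforce
    ultimately show ?thesis
      by simp
  qed
  then have "multipartitions n r \<subseteq> {lam. set lam \<subseteq> ?P \<and> length lam = r}"
    by (auto simp: multipartitions_def)
  moreover have "finite {lam. set lam \<subseteq> ?P \<and> length lam = r}"
    by (intro finite_lists_length_eq finite_lists_length_le) simp
  ultimately show ?thesis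
    by (rule finite_subset)
qed

lemma block_start_le:
  assumes "lam \<in> multipartitions n r" "k < r" "i \<in> {1..sum_list (lam ! k)}"
  shows "block_start lam k + i \<in> {1..n}"
proof -
  have "(\<Sum>j<Suc k. sum_list (lam ! j)) \<le> (\<Sum>j<r. sum_list (lam ! j))"
    using assms by (intro sum_mono2) auto
  then show ?thesis
    using assms by (auto simp: block_start_def multipartitions_def)
qed

section \<open>Rotation of a multipartition and the resulting twist by the character
  \<open>\<zeta>\<close>\<close>

context wreath_irreps
begin

definition rotate_index :: "nat \<Rightarrow> nat"
  where "rotate_index k = (if k < r then Suc k mod r else k)"

lemma rotate_index_permutes: "rotate_index permutes {..<r}"
proof (rule bij_imp_permutes)
  have "inj_on rotate_index {..<r}"
    by (auto simp: rotate_index_def inj_on_def mod_Suc split: if_splits)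
  moreover have "rotate_index ` {..<r} \<subseteq> {..<r}"
    using r_pos by (auto simp: rotate_index_def)
  ultimately show "bij_betw rotate_index {..<r} {..<r}"
    by (simp add: bij_betw_def endo_inj_surj)
qed (simp add: rotate_index_def)

lemma block_match_rotate1:
  assumes lam: "lam \<in> multipartitions n r"
  obtains \<sigma> where "block_match lam (rotate1 lam) \<sigma> rotate_index"
proof
  let ?a = "sum_list (lam ! 0)"
  \<comment> \<open>The first block, of length \<open>?a\<close>, goes to the end; everything after
    it moves down by \<open>?a\<close>.\<close>
  let ?\<sigma> = "\<lambda>i. if i \<in> {1..?a} then i + (n - ?a) else if i \<in> {?a + 1..n} then i - ?a else i"
  have len: "length lam = r" and n: "(\<Sum>k<r. sum_list (lam ! k)) = n"
    using lam by (auto simp: multipartitions_def)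
  obtain q where q: "r = Suc q"
    using r_pos by (cases r) auto
  have a: "?a \<le> n"
    using n q by (simp add: sum.lessThan_Suc_shift del: sum.lessThan_Suc)
  have nth: "rotate1 lam ! k = lam ! rotate_index k" if "k < r" for k
    using that len by (simp add: nth_rotate1 rotate_index_def)
  have start: "block_start (rotate1 lam) k + ?a = block_start lam (Suc k)" if "k < r" for k
  proof -
    have "block_start (rotate1 lam) k = (\<Sum>j<k. sum_list (lam ! Suc j))"
      unfolding block_start_def using that nth
      by (intro sum.cong) (auto simp: rotate_index_def)
    then show ?thesis
      by (simp add: block_start_def sum.lessThan_Suc_shift del: sum.lessThan_Suc)
  qed
  have "?\<sigma> permutes {1..n}"
  proof (rule bij_imp_permutes)
    have inj: "inj_on ?\<sigma> {1..n}"
      using a by (auto simp: inj_on_def split: if_splits)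
    moreover have "?\<sigma> ` {1..n} \<subseteq> {1..n}"
      using a by auto
    ultimately show "bij_betw ?\<sigma> {1..n} {1..n}"
      by (intro bij_betw_imageI[OF inj] endo_inj_surj[OF finite_atLeastAtMost])
  qed (use a in auto)
  moreover have "?\<sigma> (block_start lam (rotate_index k) + i) = block_start (rotate1 lam) k + i"
    if k: "k < r" and i: "i \<in> {1..sum_list (rotate1 lam ! k)}" for k i
  proof (cases "Suc k = r")
    case True
    then have "rotate_index k = 0"
      by (simp add: rotate_index_def)
    \<comment> \<open>For the last index, \<open>start\<close> refers to
      \<open>block_start lam r\<close>, which is the total size \<open>n\<close>.\<close>
    moreover have "block_start (rotate1 lam) k = n - ?a"
      using start[OF k] n True by (simp add: block_start_def)
    ultimately show ?thesis
      using i nth[OF k] by (simp add: block_start_def)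
  next
    case False
    then have c: "rotate_index k = Suc k"
      using k by (simp add: rotate_index_def)
    have "block_start lam (Suc k) + i \<le> n"
      using block_start_le[OF lam, of "Suc k" i] k i False nth[OF k] c by auto
    then show ?thesis
      using start[OF k] i c by auto
  qed
  ultimately show "block_match lam (rotate1 lam) ?\<sigma> rotate_index"
    using rotate_index_permutes nth block_start_le[OF lam] permutes_in_image[OF rotate_index_permutes]
    by (auto simp: block_match_def)
qed

lemma zeta_char_blocks:
  assumes "lam \<in> multipartitions n r"
  shows "(\<Prod>k<r. zeta_char \<zeta> (sum_list (lam ! k)) (young_component lam h k)) = zeta_char \<zeta> n h"
proof -
  have "zeta_char \<zeta> (sum_list (lam ! k)) (young_component lam h k) =
      (\<Prod>i\<in>{1..sum_list (lam ! k)}. \<zeta> powi fst h (block_start lam k + i))" for k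
    by (cases h) (simp add: zeta_char_prod young_component_def)
  then show ?thesis
    using assms prod_blocks[of "\<lambda>i. \<zeta> powi fst h i" "\<lambda>k. sum_list (lam ! k)" r]
    by (simp add: multipartitions_def zeta_char_prod block_start_def)
qed

text \<open>A block with index \<open>k + 1\<close> in \<open>lam\<close> has index \<open>k\<close>
  after rotation, so its character loses one factor. The factors lost on all blocks multiply up to
  \<open>zeta_char \<zeta> n h\<close>.\<close>

lemma young_scalar_rotate1:
  assumes lam: "lam \<in> multipartitions n r"
    and m: "block_match lam (rotate1 lam) \<sigma> rotate_index" and h: "h \<in> Y lam"
  shows "young_scalar (rotate1 lam) (perm_elt \<sigma> \<otimes>\<^bsub>G\<^esub> h \<otimes>\<^bsub>G\<^esub> inv\<^bsub>G\<^esub> (perm_elt \<sigma>)) * zeta_char \<zeta> n h =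
    young_scalar lam h"
proof -
  let ?h' = "perm_elt \<sigma> \<otimes>\<^bsub>G\<^esub> h \<otimes>\<^bsub>G\<^esub> inv\<^bsub>G\<^esub> (perm_elt \<sigma>)"
  define Z where "Z k = zeta_char \<zeta> (sum_list (lam ! k)) (young_component lam h k)" for k
  have Z_r: "Z k ^ r = 1" for k
    by (simp add: Z_def zeta_char_pow_r)
  have reindex: "(\<Prod>k<r. f (rotate_index k)) = (\<Prod>k<r. f k)" for f :: "nat \<Rightarrow> complex"
    by (rule prod.reindex_bij_betw[OF permutes_imp_bij[OF rotate_index_permutes]])
  have "young_scalar (rotate1 lam) ?h' = (\<Prod>k<r. Z (rotate_index k) ^ k)"
    using m young_conj(2)[OF m h] by (auto simp: young_scalar_def Z_def block_match_def)
  moreover have "zeta_char \<zeta> n h = (\<Prod>k<r. Z (rotate_index k))"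
    unfolding reindex[of Z] by (simp add: Z_def zeta_char_blocks[OF lam])
  ultimately have "young_scalar (rotate1 lam) ?h' * zeta_char \<zeta> n h =
      (\<Prod>k<r. Z (rotate_index k) ^ Suc k)"
    by (simp add: prod.distrib mult.commute)
  also have "\<dots> = (\<Prod>k<r. Z (rotate_index k) ^ rotate_index k)"
  proof (rule prod.cong)
    fix k assume "k \<in> {..<r}"
    \<comment> \<open>Only \<open>k = r - 1\<close> wraps around: there the exponents are
      \<open>r\<close> and \<open>0\<close>, which agree because \<open>Z\<close> takes
      \<open>r\<close>-th roots of unity as values.\<close>
    then show "Z (rotate_index k) ^ Suc k = Z (rotate_index k) ^ rotate_index k"
      using Z_r by (cases "Suc k = r") (simp_all add: rotate_index_def del: power_Suc)
  qed simp
  also have "\<dots> = young_scalar lam h"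
    unfolding reindex[of "\<lambda>k. Z k ^ k"] by (simp add: young_scalar_def Z_def)
  finally show ?thesis .
qed

text \<open>The twist by \<open>zeta_char \<zeta> n\<close> is an isomorphism from the space of
  \<open>rotate1 lam\<close> to that of \<open>lam\<close>. It commutes with right translation by
  \<open>x\<close> up to the factor \<open>zeta_char \<zeta> n x\<close>, which the determinant
  raises to the dimension.\<close>

lemma irrep_rotate1:
  assumes lam: "lam \<in> multipartitions n r"
  shows "fvs.dim (W (rotate1 lam)) = fvs.dim (W lam)"
    and "x \<in> carrier G \<Longrightarrow> rep_det (wreath_irrep \<zeta> n r lam) x =
      zeta_char \<zeta> n x ^ fvs.dim (W lam) * rep_det (wreath_irrep \<zeta> n r (rotate1 lam)) x"
proof -
  obtain \<sigma> where m: "block_match lam (rotate1 lam) \<sigma> rotate_index"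
    by (rule block_match_rotate1[OF lam])
  let ?z = "zeta_char \<zeta> n"
  define f where "f = twist \<sigma> rotate_index ?z"
  define g where "g = twist (inv' \<sigma>) (inv' rotate_index) (\<lambda>h. inverse (?z h))"
  have \<sigma>: "\<sigma> permutes {1..n}" and c: "rotate_index permutes {..<r}"
    using m by (auto simp: block_match_def)
  note m' = block_match_sym[OF m] and \<sigma>' = permutes_inv[OF \<sigma>] and c' = permutes_inv[OF c]
  note s = perm_elt_carrier[OF \<sigma>] perm_elt_carrier[OF \<sigma>']
  have inv_s: "perm_elt (inv' \<sigma>) = inv\<^bsub>G\<^esub> (perm_elt \<sigma>)"
    using inv_perm_elt[OF \<sigma>] ..
  have f: "f ` W (rotate1 lam) \<subseteq> W lam"
    unfolding f_def
    using twist_mem[OF m zeta_char_mult young_scalar_rotate1[OF lam m]] by auto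
  \<comment> \<open>The scalar condition for the inverse twist is the forward one read at the
    conjugate \<open>k\<close> of \<open>h\<close>; conjugation by a permutation leaves
    \<open>zeta_char\<close> unchanged.\<close>
  have "young_scalar lam (perm_elt (inv' \<sigma>) \<otimes>\<^bsub>G\<^esub> h \<otimes>\<^bsub>G\<^esub> inv\<^bsub>G\<^esub> (perm_elt (inv' \<sigma>))) * inverse (?z h) =
      young_scalar (rotate1 lam) h" if "h \<in> Y (rotate1 lam)" for h
  proof -
    define k where "k = perm_elt (inv' \<sigma>) \<otimes>\<^bsub>G\<^esub> h \<otimes>\<^bsub>G\<^esub> inv\<^bsub>G\<^esub> (perm_elt (inv' \<sigma>))"
    have hG: "h \<in> carrier G"
      using that by (simp add: mem_young)
    have "k \<in> Y lam"
      unfolding k_def by (rule young_conj(1)[OF m' that])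
    note scalar = young_scalar_rotate1[OF lam m this]
    have kG: "k \<in> carrier G"
      using s hG by (simp add: k_def)
    have "perm_elt \<sigma> \<otimes>\<^bsub>G\<^esub> k \<otimes>\<^bsub>G\<^esub> inv\<^bsub>G\<^esub> (perm_elt \<sigma>) = h"
      using s hG unfolding k_def inv_s
      by (simp add: m_assoc) (simp flip: m_assoc)
    moreover from this have "?z k = ?z h"
      using s kG zeta_char_mult zeta_char_perm_elt inv_s
      by (metis inv_closed m_closed mult.left_neutral mult.right_neutral)
    ultimately show ?thesis
      using scalar zeta_char_nz by (simp add: k_def field_simps)
  qed
  then have g: "g ` W lam \<subseteq> W (rotate1 lam)"
    unfolding g_def using twist_mem[OF m', of "\<lambda>h. inverse (?z h)"] by (auto simp: zeta_char_mult)
  have gf: "g (f F) = F" if "F \<in> W (rotate1 lam)" for F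
    unfolding f_def g_def
    by (rule twist_twist[OF \<sigma> c zeta_char_mult zeta_char_perm_elt _ that])
      (simp_all add: zeta_char_nz)
  have fg: "f (g F) = F" if "F \<in> W lam" for F
    using twist_twist[OF \<sigma>' c', of "\<lambda>h. inverse (?z h)" ?z F lam] that
    by (simp add: f_def g_def inv_inv_eq permutes_bij[OF \<sigma>] permutes_bij[OF c] zeta_char_mult
        zeta_char_perm_elt zeta_char_nz)
  have lin: "Vector_Spaces.linear fscale fscale f" "Vector_Spaces.linear fscale fscale g"
    by (simp_all add: f_def g_def linear_twist)
  note intertwine = op_det_intertwine[OF irrep_basis irrep_basis lin(1) f lin(2) g gf fg]
  show dim: "fvs.dim (W (rotate1 lam)) = fvs.dim (W lam)"
    using intertwine(1) by simp
  assume x: "x \<in> carrier G"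
  have "rep_act (wreath_irrep \<zeta> n r lam) x (f F) =
      fscale (?z x) (f (rep_act (wreath_irrep \<zeta> n r (rotate1 lam)) x F))" for F
    using x s by (auto simp: f_def twist_def irrep_act fscale_def fun_eq_iff zeta_char_mult m_assoc)
  then show "rep_det (wreath_irrep \<zeta> n r lam) x =
      ?z x ^ fvs.dim (W lam) * rep_det (wreath_irrep \<zeta> n r (rotate1 lam)) x"
    unfolding rep_det_def dim[symmetric]
    by (intro intertwine(2) linear_irrep_act) (auto simp: irrep_act_closed x)
qed

lemma irrep_rotate:
  assumes lam: "lam \<in> multipartitions n r"
  shows "rotate j lam \<in> multipartitions n r"
    and "fvs.dim (W (rotate j lam)) = fvs.dim (W lam)"
    and "x \<in> carrier G \<Longrightarrow> rep_det (wreath_irrep \<zeta> n r lam) x =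
      zeta_char \<zeta> n x ^ (j * fvs.dim (W lam)) * rep_det (wreath_irrep \<zeta> n r (rotate j lam)) x"
proof (induction j)
  case (Suc j)
  { case 1 then show ?case
      using Suc(1) by (simp add: multipartitions_rotate1) }
  { case 2 then show ?case
      using Suc(1,2) by (simp add: irrep_rotate1) }
  { case 3 then show ?case
      using Suc irrep_rotate1(2)[OF Suc(1)] by (simp add: power_add mult.commute) }
qed (simp_all add: lam)

section \<open>The central element\<close>

definition central :: wr
  where "central = (\<lambda>i\<in>{1..n}. 1, id)"

text \<open>The coordinate 1 is a reduced residue once \<open>r \<ge> 2\<close>, and the identity
  permutation preserves every block.\<close>

lemma central_young:
  assumes "r \<ge> 2"
  shows "central \<in> Y lam"
  using assms
  by (auto simp: mem_young central_def carrier_wreath carrier_integer_mod_group permutes_id)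

lemma central_commute:
  assumes "g \<in> carrier G"
  shows "g \<otimes>\<^bsub>G\<^esub> central = central \<otimes>\<^bsub>G\<^esub> g"
proof -
  have "inv' (snd g) i \<in> {1..n}" if "i \<in> {1..n}" for i
    using permutes_in_image[OF permutes_inv, of "snd g" "{1..n}" i] that assms
    by (simp add: carrier_wreath)
  then show ?thesis
    by (auto simp: mult_wreath central_def add.commute intro!: restrict_ext)
qed

lemma young_move_central: "young_move lam central b = b"
proof -
  have "snd (young_component lam central k) = id" for k
    by (auto simp: young_component_def central_def)
  then show ?thesis
    by (intro ext) (simp add: young_move_def tabloid_act_def)
qed

text \<open>For a central element right translation is left translation, and since it lies in the
  Young subgroup and moves no tabloid, covariance turns this into a scalar.\<close>

lemma rep_det_central:
  assumes "r \<ge> 2"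
  shows "rep_det (wreath_irrep \<zeta> n r lam) central = young_scalar lam central ^ fvs.dim (W lam)"
  unfolding rep_det_def
proof (rule op_det_scalar[OF irrep_basis])
  fix F assume F: "F \<in> W lam"
  have "F (central \<otimes>\<^bsub>G\<^esub> g, b) = young_scalar lam central * F (g, b)" if "g \<in> carrier G" for g b
  proof -
    have "F (central \<otimes>\<^bsub>G\<^esub> g, b) = young_scalar lam central * F (g, young_move lam central b)"
      using F that central_young[OF assms, of lam] unfolding mem_irrep by blast
    then show ?thesis
      by (simp only: young_move_central)
  qed
  moreover have "F (g, b) = 0" if "g \<notin> carrier G" for g b
    using F that unfolding mem_irrep by blast
  ultimately show "rep_act (wreath_irrep \<zeta> n r lam) central F = fscale (young_scalar lam central) F"
    by (auto simp: irrep_act fscale_def fun_eq_iff central_commute)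
qed

lemma young_scalar_pow_r: "young_scalar lam h ^ r = 1"
proof -
  have "(zeta_char \<zeta> (sum_list (lam ! k)) (young_component lam h k) ^ k) ^ r = 1" for k
    by (simp only: power_mult[symmetric] mult.commute[of k r])
      (simp only: power_mult zeta_char_pow_r power_one)
  then show ?thesis
    by (simp add: young_scalar_def prod_power_distrib)
qed

lemma zeta_char_central: "zeta_char \<zeta> n central = \<zeta> ^ n"
  by (simp add: zeta_char_prod central_def)

text \<open>Otherwise the determinant at \<open>central\<close> would be an \<open>r\<close>-th root
  of unity raised to a multiple of \<open>r\<close>, hence 1, while its prescribed value is
  \<open>\<zeta> ^ (n * s)\<close>. The factor \<open>e\<close> stands for the trivial character or
  the sign.\<close>

lemma dim_not_dvd:
  assumes "r \<ge> 2" "\<not> r dvd n * s" "primitive_root r \<zeta>"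
    and "\<And>g. g \<in> carrier G \<Longrightarrow> rep_det (wreath_irrep \<zeta> n r lam) g = zeta_char \<zeta> n g ^ s * e g"
    and "e central = 1"
  shows "\<not> r dvd fvs.dim (W lam)"
proof
  assume "r dvd fvs.dim (W lam)"
  then have "young_scalar lam central ^ fvs.dim (W lam) = 1"
    by (auto simp: power_mult young_scalar_pow_r elim!: dvdE)
  moreover have "central \<in> carrier G"
    using central_young[OF assms(1)] by (simp add: mem_young)
  ultimately have "\<zeta> ^ (n * s) = 1"
    using assms(4)[of central] assms(5) rep_det_central[OF assms(1), of lam]
    by (simp add: zeta_char_central power_mult)
  moreover have "\<zeta> ^ (n * s) = \<zeta> ^ (n * s mod r)"
    by (rule power_eq_power_mod[OF root])
  moreover have "0 < n * s mod r" "n * s mod r < r"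
    using assms(2) r_pos by (simp_all add: dvd_eq_mod_eq_0)
  ultimately show False
    using assms(3) by (auto simp: primitive_root_def)
qed

section \<open>Comparison of the counts by an injective rotation\<close>

lemma card_det_le:
  assumes "Factorial_Ring.prime r" "primitive_root r \<zeta>" "\<not> r dvd n" "1 \<le> s" "s < r"
    and e: "e central = 1"
  shows "card {lam \<in> multipartitions n r. \<forall>g\<in>carrier G.
      rep_det (wreath_irrep \<zeta> n r lam) g = zeta_char \<zeta> n g ^ s * e g} \<le>
    card {lam \<in> multipartitions n r. \<forall>g\<in>carrier G.
      rep_det (wreath_irrep \<zeta> n r lam) g = zeta_char \<zeta> n g ^ r * e g}"
    (is "card ?S \<le> card ?R")
proof -
  have r2: "r \<ge> 2"
    using assms(1) prime_ge_2_nat by blast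
  have "\<not> r dvd s"
    using assms(4,5) by (auto dest: dvd_imp_le)
  then have ns: "\<not> r dvd n * s"
    using assms(1,3) prime_dvd_mult_iff by blast
  \<comment> \<open>As \<open>r\<close> is prime, \<open>d\<close> is invertible modulo
    \<open>r\<close>; the solution is \<open>s\<close> times its inverse.\<close>
  have "\<exists>j. [j * d = s] (mod r)" if d: "\<not> r dvd d" for d
  proof -
    obtain j where "[d * j = 1] (mod r)"
      using cong_solve_coprime_nat[of d r] prime_imp_coprime[OF assms(1) d]
      by (auto simp: coprime_commute)
    then have "[d * j * s = 1 * s] (mod r)"
      by (rule cong_scalar_right)
    then show ?thesis
      by (intro exI[of _ "j * s"]) (simp add: ac_simps)
  qed
  then obtain J where J: "\<And>d. \<not> r dvd d \<Longrightarrow> [J d * d = s] (mod r)"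
    by metis
  \<comment> \<open>The number of steps depends only on the dimension, which rotation preserves. Two
    arguments with the same image are thus rotated by the same amount and must coincide.\<close>
  let ?\<phi> = "\<lambda>lam. rotate (J (fvs.dim (W lam))) lam"
  show ?thesis
  proof (rule card_inj_on_le)
    show "finite ?R"
      using finite_multipartitions by simp
    show "inj_on ?\<phi> ?S"
    proof (rule inj_onI)
      fix lam lam' assume lam: "lam \<in> ?S" "lam' \<in> ?S" and eq: "?\<phi> lam = ?\<phi> lam'"
      then have "fvs.dim (W lam) = fvs.dim (W lam')"
        using irrep_rotate(2)[of lam "J (fvs.dim (W lam))"]
          irrep_rotate(2)[of lam' "J (fvs.dim (W lam'))"] by simp
      then have "rotate (J (fvs.dim (W lam))) lam = rotate (J (fvs.dim (W lam))) lam'"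
        using eq by simp
      then show "lam = lam'"
        using inj_fn[OF inj_rotate1] by (auto simp: rotate_def dest: injD)
    qed
    show "?\<phi> ` ?S \<subseteq> ?R"
    proof (clarify, intro conjI ballI)
      fix lam
      assume lam: "lam \<in> multipartitions n r" and det: "\<forall>g\<in>carrier G.
        rep_det (wreath_irrep \<zeta> n r lam) g = zeta_char \<zeta> n g ^ s * e g"
      show "?\<phi> lam \<in> multipartitions n r"
        by (rule irrep_rotate(1)[OF lam])
      fix g assume g: "g \<in> carrier G"
      let ?z = "zeta_char \<zeta> n g" and ?d = "fvs.dim (W lam)"
      have "\<not> r dvd ?d"
        using det e by (intro dim_not_dvd[OF r2 ns assms(2), where e = e]) auto
      then have "J ?d * ?d mod r = s mod r"
        using J unfolding cong_def by blast
      then have "?z ^ (J ?d * ?d) = ?z ^ s"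
        using power_eq_power_mod[OF zeta_char_pow_r, of n g "J ?d * ?d"]
          power_eq_power_mod[OF zeta_char_pow_r, of n g s] by simp
      then have "rep_det (wreath_irrep \<zeta> n r (?\<phi> lam)) g = e g"
        using irrep_rotate(3)[OF lam g, of "J ?d"] det g zeta_char_nz by simp
      \<comment> \<open>The trivial power of the character is written with exponent
        \<open>r\<close>, matching N_1 as the count for \<zeta> to the power r.\<close>
      then show "rep_det (wreath_irrep \<zeta> n r (?\<phi> lam)) g = ?z ^ r * e g"
        by (simp add: zeta_char_pow_r)
    qed
  qed
qed

end

theorem proposition7:
  fixes r n s :: nat and \<zeta> :: complex
  assumes "Factorial_Ring.prime r" and "odd r"
    and "n \<ge> 1" and "\<not> r dvd n"
    and "primitive_root r \<zeta>"
    and "1 \<le> s" and "s < r"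
  shows "N_plus \<zeta> r s n \<le> N_plus \<zeta> r r n \<and> N_minus \<zeta> r s n \<le> N_minus \<zeta> r r n"
proof -
  interpret wreath_irreps n r \<zeta>
    using assms(1,5) by unfold_locales (auto simp: primitive_root_def prime_gt_0_nat)
  note le = card_det_le[OF assms(1,5,4,6,7)]
  have "sgn_char central = 1"
    by (simp add: sgn_char_def central_def)
  \<comment> \<open>The factor \<open>e\<close> is constantly 1 for \<open>N_plus\<close> and the
    sign for \<open>N_minus\<close>; for \<open>n = 1\<close> both values of \<open>N_minus\<close>
    are 0 by convention.\<close>
  then show ?thesis
    using le[of "\<lambda>_. 1"] le[of sgn_char] by (simp add: N_plus_def N_minus_def)
qed

end
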